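(* Assume $n\ge 4$. Let $\mathbf{A}\in\mathbb{R}_+^{m\times n}$ be non-degenerate, let $\epsilon>0$, let $\mathbf{x}_0\in\mathcal{X}$ be arbitrary, and let $\overline{\mathbf{y}}_0=\mathbf{y}_0=\mathbf{A}\mathbf{x}_0$. Let $\mathbf{x}_k,\ \widetilde{\mathbf{x}}_k,\ A_k$ evolve according to SI-NNLS+ for $k\ge 1$, and let $\mathbf{x}^\star\in\arg\min_{\mathbf{x}\ge\mathbf{0}}f(\mathbf{x})$. Then for all $K\ge 2$, $$\mathbb{E}\big[\langle\nabla f(\widetilde{\mathbf{x}}_K),\widetilde{\mathbf{x}}_K-\mathbf{x}^\star\rangle\big]\le\frac{2\phi_0(\mathbf{x}^\star)}{A_K}=\frac{\|\mathbf{x}_0-\mathbf{x}^\star\|_{\mathbf{\Lambda}}^2}{A_K},$$ and $$\mathbb{E}\big[f(\widetilde{\mathbf{x}}_K)-f(\mathbf{x}^\star)\big]\le\frac{\phi_0(\mathbf{x}^\star)}{A_K}=\frac{\|\mathbf{x}_0-\mathbf{x}^\star\|_{\mathbf{\Lambda}}^2}{2A_K}.$$ When $K\ge\frac52 n\log n$, we have $A_K\ge\frac{(K-\frac52 n\log n)^2}{36n^2}$. If $\phi_0(\mathbf{x}^\star)\le|f(\mathbf{x}^\star)|$, then for $K\ge\frac52 n\log n+\frac{6n}{\sqrt{\epsilon}}$, $$\mathbb{E}\big[f(\widetilde{\mathbf{x}}_K)-f(\mathbf{x}^\star)\big]\le\epsilon|f(\mathbf{x}^\star)|.$$ The total (expected)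 cost, in arithmetic operations of the lazy implementation run for this number of iterations, is $O\big(\mathrm{nnz}(\mathbf{A})\big(\log n+\frac{1}{\sqrt{\epsilon}}\big)\big)$.
   Context: $\mathbf{A}\in\mathbb{R}_+^{m\times n}$ has nonnegative entries and is non-degenerate: no row or column is identically zero. $\mathbf{A}_{:j}$ is the $j$-th column, $\mathrm{nnz}(\cdot)$ is the number of nonzero entries, $\mathbf{1}$ is the all-ones vector, $\mathbf{e}_j$ is the $j$-th standard basis vector, $\log$ is the natural logarithm. $f(\mathbf{x})=\frac12\|\mathbf{A}\mathbf{x}\|_2^2-\mathbf{1}^\top\mathbf{x}$; $\mathcal{X}=\{\mathbf{x}\in\mathbb{R}^n:0\le x_j\le 1/\|\mathbf{A}_{:j}\|_2^2\ \forall j\}$; $\mathbf{\Lambda}=\mathrm{diag}(\|\mathbf{A}_{:1}\|_2^2,\dots,\|\mathbf{A}_{:n}\|_2^2)$; $\|\mathbf{x}\|_{\mathbf{\Lambda}}^2=\sum_i\|\mathbf{A}_{:i}\|_2^2x_i^2$; $\phi_0(\mathbf{x})=\frac12\|\mathbf{x}-\mathbf{x}_0\|_{\mathbf{\Lambda}}^2$. SI-NNLS+. Step sizes: $A_0=0$, $a_1=\frac{1}{\sqrt2 n^{1.5}}$, $a_2=\frac{a_1}{n-1}$, $A_k=A_{k-1}+a_k$ for $k\ge1$, and $a_k=\min\{\frac{n a_{k-1}}{n-1},\frac{\sqrt{A_{k-1}}}{2n}\}$ for $k\ge3$. Start from $\mathbf{x}_0\in\mathcal{X}$, $\overline{\mathbf{y}}_0=\mathbf{y}_0=\mathbf{A}\mathbf{x}_0$.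 For $k=1,2,\dots$: sample $j_k$ uniformly from $\{1,\dots,n\}$, independently of the history; set $\mathbf{x}_k=\arg\min_{\mathbf{x}\in\mathcal{X}}\phi_k(\mathbf{x})$ with $\phi_k(\mathbf{x})=a_1\langle\mathbf{A}^\top\overline{\mathbf{y}}_0-\mathbf{1},\mathbf{x}\rangle+\sum_{i=2}^k n a_i\langle\mathbf{A}^\top\overline{\mathbf{y}}_{i-1}-\mathbf{1},x_{j_i}\mathbf{e}_{j_i}\rangle+\phi_0(\mathbf{x})$; $\mathbf{y}_k=\arg\max_{\mathbf{y}\in\mathbb{R}^m}\psi_k(\mathbf{y})$ with $\psi_k(\mathbf{y})=a_1\langle\mathbf{A}^\top\mathbf{y}-\mathbf{1},\mathbf{x}_1\rangle+\sum_{i=2}^k a_i\langle\mathbf{A}^\top\mathbf{y}-\mathbf{1},n\mathbf{x}_i-(n-1)\mathbf{x}_{i-1}\rangle-\frac{A_k}{2}\|\mathbf{y}\|_2^2$; $\overline{\mathbf{y}}_k=\mathbf{y}_k+\frac{a_k}{a_{k+1}}(\mathbf{y}_k-\mathbf{y}_{k-1})$. The output sequence is $\widetilde{\mathbf{x}}_1=\mathbf{x}_1$ and $\widetilde{\mathbf{x}}_k=\frac1{A_k}\big[A_{k-1}\widetilde{\mathbf{x}}_{k-1}+a_k(n\mathbf{x}_k-(n-1)\mathbf{x}_{k-1})\big]$ for $k\ge2$. Expectations are over the random coordinates $j_k$. Lazy implementation: the same iterates are generated but $\widetilde{\mathbf{x}}_k,\mathbf{y}_k,\overline{\mathbf{y}}_k$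 are kept implicitly through $\mathbf{x}_k$, $\mathbf{A}\mathbf{x}_k$, $\mathbf{r}_k$, $\mathbf{s}_k$ and $\mathbf{A}(\mathbf{x}_k-\mathbf{x}_{k-1})$, where $\mathbf{r}_1=\mathbf{0}$, $\mathbf{s}_1=\mathbf{0}$ and for $k\ge 2$, $\mathbf{r}_k=\mathbf{r}_{k-1}+((n-1)a_k-A_{k-1})(\mathbf{x}_k-\mathbf{x}_{k-1})$, $\mathbf{s}_k=\mathbf{s}_{k-1}+((n-1)a_k-A_{k-1})\mathbf{A}(\mathbf{x}_k-\mathbf{x}_{k-1})$, so that $\widetilde{\mathbf{x}}_k=\mathbf{x}_k+\mathbf{r}_k/A_k$, $\mathbf{y}_k=\mathbf{A}\mathbf{x}_k+\mathbf{s}_k/A_k$; only the entries touched by the sampled column are read and updated, so an iteration $k\ge2$ costs $O(\mathrm{nnz}(\mathbf{A}_{:j_k}))$ operations, and $\widetilde{\mathbf{x}}_K$ is formed only at the end. *)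

theory Defs
  imports "HOL-Probability.Probability" "Jordan_Normal_Form.Matrix"
begin

unbundle no vec_syntax
unbundle no inner_syntax

text \<open>Coordinates are numbered \<open>0, \<dots>, n - 1\<close>, as usual for the type of matrices used here.\<close>

definition nonneg_nondegenerate :: "real mat \<Rightarrow> bool" where
  "nonneg_nondegenerate A \<longleftrightarrow>
     (\<forall>i<dim_row A. \<forall>j<dim_col A. 0 \<le> A $$ (i, j)) \<and>
     (\<forall>i<dim_row A. \<exists>j<dim_col A. A $$ (i, j) \<noteq> 0) \<and>
     (\<forall>j<dim_col A. \<exists>i<dim_row A. A $$ (i, j) \<noteq> 0)"

definition nnz :: "real mat \<Rightarrow> nat" where
  "nnz A = card {(i, j). i < dim_row A \<and> j < dim_col A \<and> A $$ (i, j) \<noteq> 0}"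

definition ones :: "nat \<Rightarrow> real vec" where
  "ones n = vec n (\<lambda>_. 1)"

definition sq_norm :: "real vec \<Rightarrow> real" where
  "sq_norm v = v \<bullet> v"

definition nnls_obj :: "real mat \<Rightarrow> real vec \<Rightarrow> real" where
  "nnls_obj A x = 1/2 * sq_norm (A *\<^sub>v x) - ones (dim_col A) \<bullet> x"

definition gradient :: "(real vec \<Rightarrow> real) \<Rightarrow> real vec \<Rightarrow> real vec" where
  "gradient F x = vec (dim_vec x)
     (\<lambda>i. deriv (\<lambda>t. F (x + t \<cdot>\<^sub>v unit_vec (dim_vec x) i)) 0)"

definition nonneg_orthant :: "nat \<Rightarrow> real vec set" where
  "nonneg_orthant n = {x \<in> carrier_vec n. \<forall>j<n. 0 \<le> x $ j}"

definition nnls_box :: "real mat \<Rightarrow> real vec set" where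
  "nnls_box A = {x \<in> carrier_vec (dim_col A).
     \<forall>j<dim_col A. 0 \<le> x $ j \<and> x $ j \<le> 1 / sq_norm (col A j)}"

definition sq_norm_Lambda :: "real mat \<Rightarrow> real vec \<Rightarrow> real" where
  "sq_norm_Lambda A x = (\<Sum>j<dim_col A. sq_norm (col A j) * (x $ j)\<^sup>2)"

definition phi0 :: "real mat \<Rightarrow> real vec \<Rightarrow> real vec \<Rightarrow> real" where
  "phi0 A x0 x = 1/2 * sq_norm_Lambda A (x - x0)"

text \<open>\<open>step_size n k\<close> is $a_k$ and \<open>step_sum n k\<close> is $A_k$; the value of $a_0$ is never used.\<close>

function step_size :: "nat \<Rightarrow> nat \<Rightarrow> real" and step_sum :: "nat \<Rightarrow> nat \<Rightarrow> real" where
  "step_size n 0 = 0"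
| "step_size n (Suc 0) = 1 / (sqrt 2 * real n powr (3/2))"
| "step_size n (Suc (Suc 0)) = step_size n 1 / (real n - 1)"
| "step_size n (Suc (Suc (Suc k))) =
     min (real n * step_size n (k + 2) / (real n - 1)) (sqrt (step_sum n (k + 2)) / (2 * real n))"
| "step_sum n 0 = 0"
| "step_sum n (Suc k) = step_sum n k + step_size n (Suc k)"
  by pat_completeness auto
termination
  by (relation "Wellfounded.measure (\<lambda>z. case z of Inl (n, k) \<Rightarrow> 2 * k | Inr (n, k) \<Rightarrow> 2 * k + 1)") auto

text \<open>In the following, \<open>j k\<close> is the coordinate sampled in iteration \<open>k\<close>, and \<open>yb k\<close> stands
  for the extrapolated dual iterate $\overline{y}_k$.\<close>

definition phi :: "real mat \<Rightarrow> real vec \<Rightarrow> (nat \<Rightarrow> nat) \<Rightarrow> (nat \<Rightarrow> real vec) \<Rightarrow> nat \<Rightarrow> real vec \<Rightarrow> real"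
where
  "phi A x0 j yb k x = (let n = dim_col A; a = step_size n in
     a 1 * ((transpose_mat A *\<^sub>v yb 0 - ones n) \<bullet> x)
     + (\<Sum>i=2..k. real n * a i *
          ((transpose_mat A *\<^sub>v yb (i - 1) - ones n) \<bullet> (x $ j i \<cdot>\<^sub>v unit_vec n (j i))))
     + phi0 A x0 x)"

definition psi :: "real mat \<Rightarrow> (nat \<Rightarrow> real vec) \<Rightarrow> nat \<Rightarrow> real vec \<Rightarrow> real" where
  "psi A x k y = (let n = dim_col A; a = step_size n in
     a 1 * ((transpose_mat A *\<^sub>v y - ones n) \<bullet> x 1)
     + (\<Sum>i=2..k. a i *
          ((transpose_mat A *\<^sub>v y - ones n) \<bullet> (real n \<cdot>\<^sub>v x i - (real n - 1) \<cdot>\<^sub>v x (i - 1))))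
     - step_sum n k / 2 * sq_norm y)"

definition si_nnls_plus :: "real mat \<Rightarrow> real vec \<Rightarrow> (nat \<Rightarrow> nat) \<Rightarrow> (nat \<Rightarrow> real vec) \<Rightarrow>
  (nat \<Rightarrow> real vec) \<Rightarrow> (nat \<Rightarrow> real vec) \<Rightarrow> (nat \<Rightarrow> real vec) \<Rightarrow> bool" where
  "si_nnls_plus A x0 j x y yb xt \<longleftrightarrow>
     (let m = dim_row A; n = dim_col A; a = step_size n; S = step_sum n in
       x 0 = x0 \<and> y 0 = A *\<^sub>v x0 \<and> yb 0 = A *\<^sub>v x0 \<and>
       (\<forall>k\<ge>1.
          is_arg_min (phi A x0 j yb k) (\<lambda>z. z \<in> nnls_box A) (x k) \<and>
          is_arg_max (psi A x k) (\<lambda>z. z \<in> carrier_vec m) (y k) \<and>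
          yb k = y k + (a k / a (k + 1)) \<cdot>\<^sub>v (y k - y (k - 1))) \<and>
       xt 1 = x 1 \<and>
       (\<forall>k\<ge>2. xt k = (1 / S k) \<cdot>\<^sub>v
          (S (k - 1) \<cdot>\<^sub>v xt (k - 1) + a k \<cdot>\<^sub>v (real n \<cdot>\<^sub>v x k - (real n - 1) \<cdot>\<^sub>v x (k - 1)))))"

text \<open>The canonical probability space of the samples: under this measure the coordinates
  \<open>\<omega> 1, \<omega> 2, \<dots>\<close> of \<open>\<omega>\<close> are independent and uniform on \<open>{0..<n}\<close>.\<close>

definition sample_space :: "nat \<Rightarrow> (nat \<Rightarrow> nat) measure" where
  "sample_space n = PiM {1..} (\<lambda>_. uniform_count_measure {0..<n})"

text \<open>Programs carry the number of operations they have executed. Each arithmetic operation on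
  reals (including \<open>min\<close>, \<open>max\<close> and the square root) and each array write costs one unit, and
  initialising an array of length \<open>l\<close> costs \<open>l\<close> units. All real numbers in the program are
  computed through these primitives.\<close>

datatype 'a counted = Counted (result: 'a) (ops: nat)

definition ret :: "'a \<Rightarrow> 'a counted" where
  "ret v = Counted v 0"

definition bind_counted :: "'a counted \<Rightarrow> ('a \<Rightarrow> 'b counted) \<Rightarrow> 'b counted" where
  "bind_counted p q =
     Counted (result (q (result p))) (ops p + ops (q (result p)))"

adhoc_overloading Monad_Syntax.bind \<rightleftharpoons> bind_counted

definition add_op :: "real \<Rightarrow> real \<Rightarrow> real counted" (infixl \<open>+.\<close> 65) where
  "a +. b = Counted (a + b) 1"
definition sub_op :: "real \<Rightarrow> real \<Rightarrow> real counted" (infixl \<open>-.\<close> 65) where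
  "a -. b = Counted (a - b) 1"
definition mul_op :: "real \<Rightarrow> real \<Rightarrow> real counted" (infixl \<open>*.\<close> 70) where
  "a *. b = Counted (a * b) 1"
definition div_op :: "real \<Rightarrow> real \<Rightarrow> real counted" (infixl \<open>'/.\<close> 70) where
  "a /. b = Counted (a / b) 1"
definition min_op :: "real \<Rightarrow> real \<Rightarrow> real counted" where
  "min_op a b = Counted (min a b) 1"
definition max_op :: "real \<Rightarrow> real \<Rightarrow> real counted" where
  "max_op a b = Counted (max a b) 1"
definition sqrt_op :: "real \<Rightarrow> real counted" where
  "sqrt_op a = Counted (sqrt a) 1"

type_synonym array = "nat \<Rightarrow> real"

definition store :: "array \<Rightarrow> nat \<Rightarrow> real \<Rightarrow> array counted" where
  "store v i c = Counted (v(i := c)) 1"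
definition new_array :: "nat \<Rightarrow> array counted" where
  "new_array l = Counted (\<lambda>_. 0) l"

fun loop :: "('b \<Rightarrow> 'a \<Rightarrow> 'a counted) \<Rightarrow> 'b list \<Rightarrow> 'a \<Rightarrow> 'a counted" where
  "loop f [] s = ret s"
| "loop f (b # bs) s = do { t \<leftarrow> f b s; loop f bs t }"

text \<open>The matrix is stored by columns, each column being the list of its nonzero entries together
  with their row indices.\<close>

definition sparse_col :: "real mat \<Rightarrow> nat \<Rightarrow> (nat \<times> real) list" where
  "sparse_col A j = map (\<lambda>i. (i, A $$ (i, j))) (filter (\<lambda>i. A $$ (i, j) \<noteq> 0) [0..<dim_row A])"

text \<open>After iteration \<open>k\<close>, the state holds $x_k$, $r_k$ (indexed by columns), $A x_k$, $s_k$,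
  $A (x_k - x_{k-1})$ (indexed by rows), the linear part \<open>st_p\<close> of \<open>phi\<close>, the list \<open>st_supp\<close> of the
  rows in which $A (x_k - x_{k-1})$ may be nonzero, the step size \<open>st_a\<close> $= a_k$ and the sums
  \<open>st_S\<close> $= A_k$ and \<open>st_S'\<close> $= A_{k-1}$.\<close>

record lazy_state =
  st_x :: array
  st_r :: array
  st_p :: array
  st_Ax :: array
  st_s :: array
  st_d :: array
  st_supp :: "nat list"
  st_a :: real
  st_S :: real
  st_S' :: real

definition sq_norm_col :: "(nat \<times> real) list \<Rightarrow> real counted" where
  "sq_norm_col c = loop (\<lambda>(i, v) acc. do { t \<leftarrow> v *. v; acc +. t }) c 0"

definition dot_col :: "(nat \<times> real) list \<Rightarrow> array \<Rightarrow> real counted" where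
  "dot_col c y = loop (\<lambda>(i, v) acc. do { t \<leftarrow> v *. y i; acc +. t }) c 0"

definition add_col :: "(nat \<times> real) list \<Rightarrow> real \<Rightarrow> array \<Rightarrow> array counted" where
  "add_col c h y = loop (\<lambda>(i, v) w. do { t \<leftarrow> v *. h; u \<leftarrow> w i +. t; store w i u }) c y"

definition mult_sparse :: "nat \<Rightarrow> nat \<Rightarrow> (nat \<Rightarrow> (nat \<times> real) list) \<Rightarrow> array \<Rightarrow> array counted" where
  "mult_sparse m n c x = do { y \<leftarrow> new_array m; loop (\<lambda>j w. add_col (c j) (x j) w) [0..<n] y }"

text \<open>The minimiser of $p z + \frac{l}{2} (z - h)^2$ over $0 \le z \le 1/l$.\<close>

definition prox :: "real \<Rightarrow> real \<Rightarrow> real \<Rightarrow> real counted" where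
  "prox l h p = do {
     t \<leftarrow> p /. l; u \<leftarrow> h -. t; v \<leftarrow> max_op 0 u; w \<leftarrow> 1 /. l; min_op v w }"

definition sq_norms :: "nat \<Rightarrow> (nat \<Rightarrow> (nat \<times> real) list) \<Rightarrow> array counted" where
  "sq_norms n c = do {
     l \<leftarrow> new_array n;
     loop (\<lambda>j w. do { t \<leftarrow> sq_norm_col (c j); store w j t }) [0..<n] l }"

definition lazy_init :: "nat \<Rightarrow> nat \<Rightarrow> (nat \<Rightarrow> (nat \<times> real) list) \<Rightarrow> array \<Rightarrow> array \<Rightarrow>
  lazy_state counted" where
  "lazy_init m n c lam x0 = do {
     q \<leftarrow> sqrt_op (real n); q \<leftarrow> real n *. q; t \<leftarrow> sqrt_op 2; q \<leftarrow> t *. q; a \<leftarrow> 1 /. q;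
     y0 \<leftarrow> mult_sparse m n c x0;
     p \<leftarrow> new_array n;
     p \<leftarrow> loop (\<lambda>j p. do { g \<leftarrow> dot_col (c j) y0; g \<leftarrow> g -. 1; g \<leftarrow> a *. g; store p j g }) [0..<n] p;
     x \<leftarrow> new_array n;
     x \<leftarrow> loop (\<lambda>j x. do { z \<leftarrow> prox (lam j) (x0 j) (p j); store x j z }) [0..<n] x;
     y \<leftarrow> mult_sparse m n c x;
     d \<leftarrow> new_array m;
     d \<leftarrow> loop (\<lambda>i d. do { t \<leftarrow> y i -. y0 i; store d i t }) [0..<m] d;
     r \<leftarrow> new_array n;
     s \<leftarrow> new_array m;
     ret \<lparr>st_x = x, st_r = r, st_p = p, st_Ax = y, st_s = s, st_d = d, st_supp = [0..<m],
          st_a = a, st_S = a, st_S' = 0\<rparr> }"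

text \<open>Iteration \<open>k \<ge> 2\<close> with sampled coordinate \<open>j\<close>. The recursion of $y_k$ gives
  $y_1 - y_0 = A(x_1 - x_0)$ and, for $k \ge 3$,
  \[ y_{k-1} - y_{k-2} = \frac{a_{k-1}}{A_{k-2}}
       \Big((n-1) A(x_{k-1} - x_{k-2}) - \frac{s_{k-1}}{A_{k-1}}\Big), \]
  so that $\overline{y}_{k-1} = A x_{k-1} + ws \cdot s_{k-1} + wd \cdot A(x_{k-1} - x_{k-2})$
  for the weights computed in \<open>extrapolation\<close>.\<close>

definition next_step_size :: "nat \<Rightarrow> nat \<Rightarrow> lazy_state \<Rightarrow> real counted" where
  "next_step_size n k st =
     (if k = 2 then do { n1 \<leftarrow> real n -. 1; st_a st /. n1 }
      else do {
        n1 \<leftarrow> real n -. 1; t \<leftarrow> real n *. st_a st; t \<leftarrow> t /. n1;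
        u \<leftarrow> sqrt_op (st_S st); n2 \<leftarrow> 2 *. real n; u \<leftarrow> u /. n2;
        min_op t u })"

definition extrapolation :: "nat \<Rightarrow> nat \<Rightarrow> lazy_state \<Rightarrow> real \<Rightarrow> (real \<times> real) counted" where
  "extrapolation n k st a' = do {
     q \<leftarrow> st_a st /. a';
     if k = 2 then do { ws \<leftarrow> 1 /. st_S st; ret (ws, q) }
     else do {
       t \<leftarrow> st_a st /. st_S' st; q \<leftarrow> q *. t;
       n1 \<leftarrow> real n -. 1; wd \<leftarrow> q *. n1;
       u \<leftarrow> 1 -. q; ws \<leftarrow> u /. st_S st;
       ret (ws, wd) } }"

definition dot_extrapolated :: "(nat \<times> real) list \<Rightarrow> real \<times> real \<Rightarrow> lazy_state \<Rightarrow> real counted" where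
  "dot_extrapolated c w st = loop (\<lambda>(i, v) acc. do {
     t \<leftarrow> fst w *. st_s st i; t \<leftarrow> st_Ax st i +. t;
     u \<leftarrow> snd w *. st_d st i; t \<leftarrow> t +. u;
     t \<leftarrow> v *. t; acc +. t }) c 0"

definition lazy_step :: "nat \<Rightarrow> (nat \<Rightarrow> (nat \<times> real) list) \<Rightarrow> array \<Rightarrow> array \<Rightarrow> nat \<Rightarrow> nat \<Rightarrow>
  lazy_state \<Rightarrow> lazy_state counted" where
  "lazy_step n c lam x0 k j st = do {
     a' \<leftarrow> next_step_size n k st;
     w \<leftarrow> extrapolation n k st a';
     g \<leftarrow> dot_extrapolated (c j) w st;
     g \<leftarrow> g -. 1; b \<leftarrow> real n *. a'; g \<leftarrow> b *. g; g \<leftarrow> st_p st j +. g;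
     p \<leftarrow> store (st_p st) j g;
     z \<leftarrow> prox (lam j) (x0 j) g;
     dx \<leftarrow> z -. st_x st j;
     x \<leftarrow> store (st_x st) j z;
     n1 \<leftarrow> real n -. 1; h \<leftarrow> n1 *. a'; h \<leftarrow> h -. st_S st; h \<leftarrow> h *. dx;
     t \<leftarrow> st_r st j +. h;
     r \<leftarrow> store (st_r st) j t;
     s \<leftarrow> add_col (c j) h (st_s st);
     y \<leftarrow> add_col (c j) dx (st_Ax st);
     d \<leftarrow> loop (\<lambda>i d. store d i 0) (st_supp st) (st_d st);
     d \<leftarrow> add_col (c j) dx d;
     S' \<leftarrow> st_S st +. a';
     ret \<lparr>st_x = x, st_r = r, st_p = p, st_Ax = y, st_s = s, st_d = d, st_supp = map fst (c j),
          st_a = a', st_S = S', st_S' = st_S st\<rparr> }"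

definition lazy_run :: "real mat \<Rightarrow> real vec \<Rightarrow> (nat \<Rightarrow> nat) \<Rightarrow> nat \<Rightarrow> real vec counted" where
  "lazy_run A x0 j K = (let m = dim_row A; n = dim_col A; c = sparse_col A in do {
     lam \<leftarrow> sq_norms n c;
     st \<leftarrow> lazy_init m n c lam (($) x0);
     st \<leftarrow> loop (\<lambda>k st. lazy_step n c lam (($) x0) k (j k) st) [2..<Suc K] st;
     z \<leftarrow> new_array n;
     z \<leftarrow> loop (\<lambda>j z. do {
            t \<leftarrow> st_r st j /. st_S st; t \<leftarrow> st_x st j +. t; store z j t }) [0..<n] z;
     ret (vec n z) })"

lemma result_simps:
  "result (ret v) = v" "result (bind_counted p q) = result (q (result p))"
  "result (a +. b) = a + b" "result (a -. b) = a - b" "result (a *. b) = a * b"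
  "result (a /. b) = a / b" "result (min_op a b) = min a b" "result (max_op a b) = max a b"
  "result (sqrt_op a) = sqrt a" "result (store w i c) = w(i := c)"
  "result (new_array l) = (\<lambda>_. 0)"
  by (simp_all add: ret_def bind_counted_def add_op_def sub_op_def mul_op_def div_op_def
      min_op_def max_op_def sqrt_op_def store_def new_array_def)

lemma result_loop: "result (loop f bs s) = fold (\<lambda>b s. result (f b s)) bs s"
  by (induction bs arbitrary: s) (simp_all add: result_simps)

lemma fold_store:
  "fold (\<lambda>j w. w(j := g j)) js w = (\<lambda>l. if l \<in> set js then g l else w l)"
  by (induction js arbitrary: w) auto

lemma sum_sparse_col:
  assumes "\<And>i. F i 0 = 0"
  shows "sum_list (map (\<lambda>(i, v). F i v) (sparse_col A j)) = (\<Sum>i<dim_row A. (F i (A $$ (i, j)) :: real))"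
proof -
  have "sum_list (map (\<lambda>i. F i (A $$ (i, j))) (filter (\<lambda>i. A $$ (i, j) \<noteq> 0) xs)) =
        sum_list (map (\<lambda>i. F i (A $$ (i, j))) xs)" for xs
    by (induction xs) (auto simp: assms)
  then show ?thesis
    by (simp add: sparse_col_def o_def interv_sum_list_conv_sum_set_nat atLeast0LessThan)
qed

lemma fold_sum: "fold (\<lambda>(i, v) acc. acc + F i v) c (s::real) = s + sum_list (map (\<lambda>(i, v). F i v) c)"
  by (induction c arbitrary: s) auto

lemma result_dot_col: "result (dot_col (sparse_col A j) y) = (\<Sum>i<dim_row A. A $$ (i, j) * y i)"
  using fold_sum[of "\<lambda>i v. v * y i" "sparse_col A j" 0] sum_sparse_col[of "\<lambda>i v. v * y i" A j]
  by (simp add: dot_col_def result_loop result_simps case_prod_unfold)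

lemma result_sq_norm_col: "result (sq_norm_col (sparse_col A j)) = (\<Sum>i<dim_row A. A $$ (i, j) * A $$ (i, j))"
  using fold_sum[of "\<lambda>i v. v * v" "sparse_col A j" 0] sum_sparse_col[of "\<lambda>i v. v * v" A j]
  by (simp add: sq_norm_col_def result_loop result_simps case_prod_unfold)

lemma fold_add:
  assumes "distinct (map fst c)"
  shows "fold (\<lambda>(i, v) w. w(i := w i + v * h)) c (y::array) =
         (\<lambda>i. y i + (\<Sum>(i', v)\<leftarrow>c. if i' = i then v * h else 0))"
  using assms
proof (induction c arbitrary: y)
  case (Cons b c)
  have "(\<Sum>(i', v)\<leftarrow>c. if i' = fst b then v * h else 0) = 0"
    using Cons.prems by (induction c) auto
  then show ?case using Cons by (auto simp: case_prod_unfold fun_eq_iff)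
qed auto

lemma distinct_sparse_col: "distinct (map fst (sparse_col A j))"
  by (simp add: sparse_col_def o_def)

lemma result_add_col: "result (add_col (sparse_col A j) h y) =
    (\<lambda>i. y i + (if i < dim_row A then A $$ (i, j) * h else 0))"
proof -
  have "(\<Sum>(i', v)\<leftarrow>sparse_col A j. if i' = i then v * h else 0) =
      (if i < dim_row A then A $$ (i, j) * h else 0)" for i
    using sum_sparse_col[of "\<lambda>i' v. if i' = i then v * h else 0" A j] by simp
  then show ?thesis
    using fold_add[OF distinct_sparse_col[of A j], of h y]
    by (simp add: add_col_def result_loop result_simps case_prod_unfold)
qed

lemma result_mult_sparse: "result (mult_sparse (dim_row A) n (sparse_col A) x) =
    (\<lambda>i. if i < dim_row A then \<Sum>j<n. A $$ (i, j) * x j else 0)"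
  by (induction n) (auto simp: mult_sparse_def result_loop result_simps result_add_col fun_eq_iff)

lemma result_sq_norms: "result (sq_norms n (sparse_col A)) =
    (\<lambda>j. if j < n then \<Sum>i<dim_row A. A $$ (i, j) * A $$ (i, j) else 0)"
  by (simp add: sq_norms_def result_loop result_simps result_sq_norm_col fold_store)

definition clip :: "real \<Rightarrow> real \<Rightarrow> real \<Rightarrow> real" where
  "clip l h p = min (max 0 (h - p / l)) (1 / l)"

lemma result_prox: "result (prox l h p) = clip l h p"
  by (simp add: prox_def result_simps clip_def)

lemma clip_less:
  assumes "l > 0" "0 \<le> z" "z \<le> 1 / l" "z \<noteq> clip l h p"
  shows "p * clip l h p + l/2 * (clip l h p - h)\<^sup>2 < p * z + l/2 * (z - h)\<^sup>2"
proof -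
  let ?c = "clip l h p"
  have "0 \<le> (?c - (h - p / l)) * (z - ?c)"
    using assms by (auto simp: clip_def min_def max_def mult_nonneg_nonneg mult_nonpos_nonpos)
  then have "0 \<le> l * ((?c - (h - p / l)) * (z - ?c))" using assms(1) by simp
  moreover have "l * ((?c - (h - p / l)) * (z - ?c)) = (p + l * (?c - h)) * (z - ?c)"
    using assms(1) by (simp add: field_simps)
  moreover have "p * z + l/2 * (z - h)\<^sup>2 - (p * ?c + l/2 * (?c - h)\<^sup>2)
      = (p + l * (?c - h)) * (z - ?c) + l/2 * (z - ?c)\<^sup>2"
    by (simp add: power2_eq_square algebra_simps)
  moreover have "l/2 * (z - ?c)\<^sup>2 > 0" using assms by simp
  ultimately show ?thesis by linarith
qed

lemma step_sum_Suc: "step_sum n (Suc k) = step_sum n k + step_size n (Suc k)"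
  by (rule step_sum.simps)

lemma step_pos:
  assumes "n \<ge> 2"
  shows "k \<ge> 1 \<Longrightarrow> step_size n k > 0 \<and> step_sum n k > 0"
proof (induction k rule: less_induct)
  case (less k)
  consider "k = 1" | "k = 2" | k' where "k = Suc (Suc (Suc k'))"
    using less.prems by (metis One_nat_def Suc_1 not0_implies_Suc not_less_eq_eq bot_nat_0.extremum)
  then show ?case
  proof cases
    case 1 then show ?thesis using assms by simp
  next
    case 2 then show ?thesis using assms by (simp add: numeral_2_eq_2 add_pos_pos)
  next
    case (3 k')
    have "step_size n (Suc (Suc k')) > 0 \<and> step_sum n (Suc (Suc k')) > 0"
      using less.IH[of "Suc (Suc k')"] 3 by simp
    then show ?thesis using 3 assms by (auto simp del: step_sum.simps intro!: add_pos_pos simp: step_sum.simps(2)[of n "Suc (Suc k')"])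
  qed
qed


declare step_size.simps [simp del] step_sum.simps [simp del]

locale si_nnls_plus_run =
  fixes A :: "real mat" and m n :: nat and x0 :: "real vec" and j :: "nat \<Rightarrow> nat"
    and x y yb xt :: "nat \<Rightarrow> real vec"
  assumes A: "A \<in> carrier_mat m n" and nd: "nonneg_nondegenerate A" and n2: "n \<ge> 2"
    and j: "\<And>k. k \<ge> 1 \<Longrightarrow> j k < n" and x0: "x0 \<in> nnls_box A"
    and alg: "si_nnls_plus A x0 j x y yb xt"
begin

abbreviation "a \<equiv> step_size n"
abbreviation "S \<equiv> step_sum n"
abbreviation "B i l \<equiv> A $$ (i, l)"

lemma dims [simp]: "dim_row A = m" "dim_col A = n"
  using A by auto

definition lm :: "nat \<Rightarrow> real" where "lm l = (\<Sum>i<m. B i l * B i l)"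
definition G :: "real vec \<Rightarrow> nat \<Rightarrow> real" where "G v l = (\<Sum>i<m. B i l * v $ i) - 1"
definition P :: "nat \<Rightarrow> nat \<Rightarrow> real" where
  "P k l = a 1 * G (yb 0) l + (\<Sum>i=2..k. if j i = l then real n * a i * G (yb (i - 1)) l else 0)"

lemma x0_carrier: "x0 \<in> carrier_vec n"
  using x0 by (auto simp: nnls_box_def)

lemma sq_norm_col_eq: "l < n \<Longrightarrow> sq_norm (col A l) = lm l"
  by (auto simp: sq_norm_def lm_def scalar_prod_def atLeast0LessThan intro!: sum.cong)

lemma lm_pos: "l < n \<Longrightarrow> lm l > 0"
proof -
  assume "l < n"
  then obtain i where "i < m" "B i l \<noteq> 0" using nd by (auto simp: nonneg_nondegenerate_def)
  then show ?thesis unfolding lm_def by (intro sum_pos2[of _ i]) (auto simp: zero_less_mult_iff)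
qed

lemma mult_index: "z \<in> carrier_vec n \<Longrightarrow> i < m \<Longrightarrow> (A *\<^sub>v z) $ i = (\<Sum>l<n. B i l * z $ l)"
  by (auto simp: scalar_prod_def atLeast0LessThan intro!: sum.cong)

lemma grad_index: "v \<in> carrier_vec m \<Longrightarrow> l < n \<Longrightarrow> (transpose_mat A *\<^sub>v v - ones n) $ l = G v l"
  by (auto simp: scalar_prod_def ones_def G_def atLeast0LessThan intro!: sum.cong)

lemma grad_scalar: "v \<in> carrier_vec m \<Longrightarrow> z \<in> carrier_vec n \<Longrightarrow>
  (transpose_mat A *\<^sub>v v - ones n) \<bullet> z = (\<Sum>l<n. G v l * z $ l)"
  using grad_index[of v] by (auto simp: scalar_prod_def[of _ z] atLeast0LessThan intro!: sum.cong)

lemma start: "x 0 = x0" "y 0 = A *\<^sub>v x0" "yb 0 = A *\<^sub>v x0" "xt 1 = x 1"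
  using alg by (auto simp: si_nnls_plus_def Let_def)

lemma
  assumes "k \<ge> 1"
  shows x_min: "is_arg_min (phi A x0 j yb k) (\<lambda>z. z \<in> nnls_box A) (x k)"
    and y_max: "is_arg_max (psi A x k) (\<lambda>z. z \<in> carrier_vec m) (y k)"
    and yb_eq: "yb k = y k + (a k / a (k + 1)) \<cdot>\<^sub>v (y k - y (k - 1))"
  using alg assms by (auto simp: si_nnls_plus_def Let_def)

lemma xt_eq: "k \<ge> 2 \<Longrightarrow> xt k = (1 / S k) \<cdot>\<^sub>v
    (S (k - 1) \<cdot>\<^sub>v xt (k - 1) + a k \<cdot>\<^sub>v (real n \<cdot>\<^sub>v x k - (real n - 1) \<cdot>\<^sub>v x (k - 1)))"
  using alg by (auto simp: si_nnls_plus_def Let_def)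

lemma x_box: "x k \<in> nnls_box A"
  using x0 x_min[of k] start by (cases "k = 0") (auto simp: is_arg_min_def)

lemma x_carrier: "x k \<in> carrier_vec n"
  using x_box[of k] by (auto simp: nnls_box_def)

lemma y_carrier: "y k \<in> carrier_vec m"
  using A x0_carrier y_max[of k] start by (cases "k = 0") (auto simp: is_arg_max_def)

lemma yb_carrier: "yb k \<in> carrier_vec m"
  using A x0_carrier y_carrier yb_eq[of k] start by (cases "k = 0") auto

lemma xt_carrier: "k \<ge> 1 \<Longrightarrow> xt k \<in> carrier_vec n"
proof (induction k)
  case (Suc k)
  then show ?case
    using xt_eq[of "Suc k"] start x_carrier by (cases "k = 0") auto
qed simp

lemma xt_index:
  assumes "k \<ge> 2" "l < n"
  shows "S k * xt k $ l = S (k - 1) * xt (k - 1) $ l + a k * (real n * x k $ l - (real n - 1) * x (k - 1) $ l)"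
proof -
  have "S k > 0" using step_pos[OF n2, of k] assms by simp
  have [simp]: "dim_vec (xt (k - 1)) = n" "dim_vec (x k) = n" "dim_vec (x (k - 1)) = n"
    using assms xt_carrier[of "k - 1"] x_carrier by auto
  have "xt k $ l = (1 / S k) * (S (k - 1) * xt (k - 1) $ l +
      a k * (real n * x k $ l - (real n - 1) * x (k - 1) $ l))"
    unfolding xt_eq[OF assms(1)] using assms(2) by (simp del: One_nat_def)
  then show ?thesis using \<open>S k > 0\<close> by simp
qed

lemma phi_eq:
  assumes z: "z \<in> carrier_vec n"
  shows "phi A x0 j yb k z = (\<Sum>l<n. P k l * z $ l + lm l / 2 * (z $ l - x0 $ l)\<^sup>2)"
proof -
  have 1: "(transpose_mat A *\<^sub>v yb (i - 1) - ones n) \<bullet> (z $ j i \<cdot>\<^sub>v unit_vec n (j i))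
      = G (yb (i - 1)) (j i) * z $ j i" if "i \<ge> 1" for i
    using j[OF that] yb_carrier[of "i - 1"] z
    by (subst grad_scalar) (auto simp: sum.delta if_distrib cong: if_cong)
  have 2: "real n * a i * ((transpose_mat A *\<^sub>v yb (i - 1) - ones n) \<bullet> (z $ j i \<cdot>\<^sub>v unit_vec n (j i)))
      = (\<Sum>l<n. (if j i = l then real n * a i * G (yb (i - 1)) l else 0) * z $ l)" if "i \<in> {2..k}" for i
  proof -
    have i: "i \<ge> 1" using that by simp
    show ?thesis
      unfolding 1[OF i] using j[OF i] by (simp add: if_distrib[of "\<lambda>u. u * _"] cong: if_cong)
  qed
  have "(\<Sum>i=2..k. real n * a i *
          ((transpose_mat A *\<^sub>v yb (i - 1) - ones n) \<bullet> (z $ j i \<cdot>\<^sub>v unit_vec n (j i)))) =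
      (\<Sum>i=2..k. \<Sum>l<n. (if j i = l then real n * a i * G (yb (i - 1)) l else 0) * z $ l)"
    by (rule sum.cong[OF refl 2])
  also have "\<dots> = (\<Sum>l<n. (\<Sum>i=2..k. if j i = l then real n * a i * G (yb (i - 1)) l else 0) * z $ l)"
    by (subst sum.swap) (simp add: sum_distrib_right)
  finally have 3: "(\<Sum>i=2..k. real n * a i *
          ((transpose_mat A *\<^sub>v yb (i - 1) - ones n) \<bullet> (z $ j i \<cdot>\<^sub>v unit_vec n (j i)))) = \<dots>" .
  have 4: "phi0 A x0 z = (\<Sum>l<n. lm l / 2 * (z $ l - x0 $ l)\<^sup>2)"
    using z x0_carrier
    by (auto simp: phi0_def sq_norm_Lambda_def sum_distrib_left sq_norm_col_eq intro!: sum.cong)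
  show ?thesis
    using grad_scalar[OF yb_carrier[of 0] z]
    unfolding phi_def Let_def dims 3 4
    by (simp add: P_def sum.distrib sum_distrib_left distrib_right mult.assoc)
qed

lemma x_clip:
  assumes "k \<ge> 1" "l < n"
  shows "x k $ l = clip (lm l) (x0 $ l) (P k l)"
proof (rule ccontr)
  assume ne: "x k $ l \<noteq> clip (lm l) (x0 $ l) (P k l)"
  define c where "c = clip (lm l) (x0 $ l) (P k l)"
  define z where "z = vec n (\<lambda>i. if i = l then c else x k $ i)"
  have b: "0 \<le> x k $ i" "x k $ i \<le> 1 / lm i" if "i < n" for i
    using x_box[of k] that sq_norm_col_eq by (auto simp: nnls_box_def)
  have c: "0 \<le> c" "c \<le> 1 / lm l"
    using lm_pos[OF assms(2)] by (auto simp: c_def clip_def)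
  have z: "z \<in> nnls_box A"
    using b c sq_norm_col_eq by (auto simp: nnls_box_def z_def)
  have zc: "z \<in> carrier_vec n" by (simp add: z_def)
  have "phi A x0 j yb k z < phi A x0 j yb k (x k)"
    unfolding phi_eq[OF x_carrier] phi_eq[OF zc]
  proof (rule sum_strict_mono_ex1)
    show "\<forall>i\<in>{..<n}. P k i * z $ i + lm i / 2 * (z $ i - x0 $ i)\<^sup>2
        \<le> P k i * x k $ i + lm i / 2 * (x k $ i - x0 $ i)\<^sup>2"
      using clip_less[OF lm_pos b ne] assms by (auto simp: z_def c_def)
    show "\<exists>i\<in>{..<n}. P k i * z $ i + lm i / 2 * (z $ i - x0 $ i)\<^sup>2
        < P k i * x k $ i + lm i / 2 * (x k $ i - x0 $ i)\<^sup>2"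
      using clip_less[OF lm_pos b ne] assms by (auto simp: z_def c_def)
  qed simp
  then show False
    using x_min[OF assms(1)] z by (auto simp: is_arg_min_def)
qed

lemma psi_eq:
  assumes "k \<ge> 1" and v: "v \<in> carrier_vec m"
  shows "psi A x k v = S k * (\<Sum>l<n. G v l * xt k $ l) - S k / 2 * sq_norm v"
proof -
  have "a 1 * (\<Sum>l<n. G v l * x 1 $ l) + (\<Sum>i=2..k. a i * (\<Sum>l<n. G v l *
      (real n * x i $ l - (real n - 1) * x (i - 1) $ l))) = (\<Sum>l<n. G v l * (S k * xt k $ l))"
    using assms(1)
  proof (induction k rule: dec_induct)
    case base
    then show ?case using start by (simp add: sum_distrib_left mult_ac step_sum.simps)
  next
    case (step k)
    have h: "S (Suc k) * xt (Suc k) $ l =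
        S k * xt k $ l + a (Suc k) * (real n * x (Suc k) $ l - (real n - 1) * x k $ l)" if "l < n" for l
      using xt_index[of "Suc k" l] step.hyps that by simp
    have "(\<Sum>l<n. G v l * (S (Suc k) * xt (Suc k) $ l)) = (\<Sum>l<n. G v l * (S k * xt k $ l) +
        a (Suc k) * (G v l * (real n * x (Suc k) $ l - (real n - 1) * x k $ l)))"
      by (intro sum.cong refl) (simp only: lessThan_iff h distrib_left mult.left_commute)
    then show ?case using step
      by (simp add: sum.distrib sum_distrib_left)
  qed
  moreover have "(transpose_mat A *\<^sub>v v - ones n) \<bullet>
      (real n \<cdot>\<^sub>v x i - (real n - 1) \<cdot>\<^sub>v x (i - 1)) = (\<Sum>l<n. G v l *
      (real n * x i $ l - (real n - 1) * x (i - 1) $ l))" for i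
    using v x_carrier[of i] x_carrier[of "i - 1"] by (subst grad_scalar) (auto intro!: sum.cong)
  ultimately show ?thesis
    using v x_carrier[of 1]
    by (simp add: psi_def Let_def grad_scalar sum_distrib_left mult_ac)
qed

lemma psi_eq':
  assumes "k \<ge> 1" and v: "v \<in> carrier_vec m"
  shows "psi A x k v = S k * ((\<Sum>i<m. v $ i * (A *\<^sub>v xt k) $ i - (v $ i)\<^sup>2 / 2) - (\<Sum>l<n. xt k $ l))"
proof -
  have "(\<Sum>l<n. G v l * xt k $ l) = (\<Sum>l<n. \<Sum>i<m. B i l * v $ i * xt k $ l) - (\<Sum>l<n. xt k $ l)"
    by (simp add: G_def left_diff_distrib sum_subtractf sum_distrib_right)
  also have "(\<Sum>l<n. \<Sum>i<m. B i l * v $ i * xt k $ l) = (\<Sum>i<m. v $ i * (A *\<^sub>v xt k) $ i)"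
    using xt_carrier[OF assms(1)]
    by (subst sum.swap) (simp add: mult_index sum_distrib_left mult_ac del: index_mult_mat_vec)
  finally have "(\<Sum>l<n. G v l * xt k $ l) = (\<Sum>i<m. v $ i * (A *\<^sub>v xt k) $ i) - (\<Sum>l<n. xt k $ l)" .
  moreover have "sq_norm v = (\<Sum>i<m. (v $ i)\<^sup>2)"
    using v by (auto simp: sq_norm_def scalar_prod_def power2_eq_square atLeast0LessThan)
  ultimately show ?thesis
    unfolding psi_eq[OF assms]
    by (simp add: sum_subtractf right_diff_distrib sum_divide_distrib[symmetric] del: index_mult_mat_vec)
qed

lemma y_eq:
  assumes "k \<ge> 1"
  shows "y k = A *\<^sub>v xt k"
proof (rule ccontr)
  define w where "w = A *\<^sub>v xt k"
  assume "y k \<noteq> A *\<^sub>v xt k"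
  moreover have w: "w \<in> carrier_vec m" using A xt_carrier[OF assms] unfolding w_def by (rule mult_mat_vec_carrier)
  moreover have "y k = w" if "\<And>i. i < m \<Longrightarrow> y k $ i = w $ i"
    using that w y_carrier[of k] by (intro eq_vecI) (simp_all add: carrier_vecD)
  ultimately obtain i where i: "i < m" "y k $ i \<noteq> w $ i"
    unfolding w_def by blast
  have eq: "u * w $ i - u\<^sup>2 / 2 = w $ i * w $ i - (w $ i)\<^sup>2 / 2 - (u - w $ i)\<^sup>2 / 2" for u i
    unfolding power2_diff by (simp add: power2_eq_square add_divide_distrib diff_divide_distrib)
  have "(\<Sum>i<m. y k $ i * w $ i - (y k $ i)\<^sup>2 / 2) < (\<Sum>i<m. w $ i * w $ i - (w $ i)\<^sup>2 / 2)"
  proof (rule sum_strict_mono_ex1)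
    show "\<forall>i\<in>{..<m}. y k $ i * w $ i - (y k $ i)\<^sup>2 / 2 \<le> w $ i * w $ i - (w $ i)\<^sup>2 / 2"
      by (simp only: eq[of "y k $ _"]) simp
    show "\<exists>i\<in>{..<m}. y k $ i * w $ i - (y k $ i)\<^sup>2 / 2 < w $ i * w $ i - (w $ i)\<^sup>2 / 2"
      using i by (intro bexI[of _ i]) (simp_all only: eq[of "y k $ _"], simp_all)
  qed simp
  then have "psi A x k (y k) < psi A x k w"
    unfolding psi_eq'[OF assms y_carrier] psi_eq'[OF assms w] w_def[symmetric]
    using step_pos[OF n2 assms] by simp
  then show False
    using y_max[OF assms] w by (auto simp: is_arg_max_def)
qed


definition AX :: "nat \<Rightarrow> nat \<Rightarrow> real" where "AX k i = (\<Sum>l<n. B i l * x k $ l)"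
definition AT :: "nat \<Rightarrow> nat \<Rightarrow> real" where "AT k i = (\<Sum>l<n. B i l * xt k $ l)"

lemma AT_rec:
  assumes "k \<ge> 2"
  shows "S k * AT k i = S (k - 1) * AT (k - 1) i + a k * (real n * AX k i - (real n - 1) * AX (k - 1) i)"
proof -
  have "S k * AT k i = (\<Sum>l<n. B i l * (S k * xt k $ l))"
    by (simp add: AT_def sum_distrib_left mult.left_commute)
  also have "\<dots> = (\<Sum>l<n. B i l * (S (k - 1) * xt (k - 1) $ l +
      a k * (real n * x k $ l - (real n - 1) * x (k - 1) $ l)))"
    using xt_index[OF assms] by (intro sum.cong) auto
  also have "\<dots> = S (k - 1) * AT (k - 1) i + a k * (real n * AX k i - (real n - 1) * AX (k - 1) i)"
    by (simp add: AT_def AX_def sum_distrib_left distrib_left right_diff_distrib sum.distrib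
        sum_subtractf mult.left_commute)
  finally show ?thesis .
qed

lemma y_index: "k \<ge> 1 \<Longrightarrow> i < m \<Longrightarrow> y k $ i = AT k i" "i < m \<Longrightarrow> y 0 $ i = AX 0 i"
  using mult_index[OF xt_carrier, of k i] mult_index[OF x_carrier, of i 0]
  by (simp_all add: y_eq AT_def AX_def start)

lemma AT_1: "AT 1 i = AX 1 i"
  by (simp add: AT_def AX_def start(4) del: One_nat_def)

lemma yb_index:
  assumes "k \<ge> 1" "i < m"
  shows "yb k $ i = y k $ i + a k / a (k + 1) * (y k $ i - y (k - 1) $ i)"
proof -
  have [simp]: "dim_vec (y k) = m" "dim_vec (y (k - 1)) = m"
    using y_carrier by auto
  show ?thesis unfolding yb_eq[OF assms(1)] using assms(2) by (simp del: One_nat_def)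
qed

lemma P_rec: "k \<ge> 2 \<Longrightarrow>
  P k l = P (k - 1) l + (if j k = l then real n * a k * G (yb (k - 1)) l else 0)"
  by (cases k) (simp_all add: P_def)

lemma P_1: "P 1 l = a 1 * G (yb 0) l" "P (Suc 0) l = a 1 * G (yb 0) l"
  by (simp_all add: P_def)

lemma x_unchanged: "k \<ge> 2 \<Longrightarrow> l < n \<Longrightarrow> l \<noteq> j k \<Longrightarrow> x k $ l = x (k - 1) $ l"
  using x_clip[of k l] x_clip[of "k - 1" l] P_rec[of k l] by simp

lemma AX_rec:
  assumes "k \<ge> 2"
  shows "AX k i = AX (k - 1) i + B i (j k) * (x k $ j k - x (k - 1) $ j k)"
proof -
  have "AX k i - AX (k - 1) i = (\<Sum>l<n. B i l * (x k $ l - x (k - 1) $ l))"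
    by (simp add: AX_def sum_subtractf right_diff_distrib)
  also have "\<dots> = (\<Sum>l<n. if l = j k then B i (j k) * (x k $ j k - x (k - 1) $ j k) else 0)"
    using x_unchanged[OF assms] by (intro sum.cong) auto
  also have "\<dots> = B i (j k) * (x k $ j k - x (k - 1) $ j k)"
    using j[of k] assms by simp
  finally show ?thesis by simp
qed

definition Inv :: "nat \<Rightarrow> lazy_state \<Rightarrow> bool" where
  "Inv k st \<longleftrightarrow>
     (\<forall>l<n. st_x st l = x k $ l \<and> st_r st l = S k * (xt k $ l - x k $ l) \<and> st_p st l = P k l) \<and>
     (\<forall>i<m. st_Ax st i = AX k i \<and> st_s st i = S k * (AT k i - AX k i) \<and>
            st_d st i = AX k i - AX (k - 1) i \<and> (i \<notin> set (st_supp st) \<longrightarrow> st_d st i = 0)) \<and>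
     st_a st = a k \<and> st_S st = S k \<and> st_S' st = S (k - 1)"

abbreviation "lam \<equiv> result (sq_norms n (sparse_col A))"

lemma lam: "l < n \<Longrightarrow> lam l = lm l"
  by (simp add: result_sq_norms lm_def)

lemma step_1: "a 1 = 1 / (sqrt 2 * (real n * sqrt (real n)))" "S 1 = a 1" "S 0 = 0"
proof -
  have "real n powr (3/2) = real n powr 1 * real n powr (1/2)"
    by (subst powr_add[symmetric]) simp
  then show "a 1 = 1 / (sqrt 2 * (real n * sqrt (real n)))"
    by (simp add: step_size.simps powr_half_sqrt)
qed (simp_all add: step_sum.simps)

lemma Inv_init: "Inv 1 (result (lazy_init m n (sparse_col A) lam (($) x0)))"
proof -
  define st where "st = result (lazy_init m n (sparse_col A) lam (($) x0))"
  have mult: "result (mult_sparse m n (sparse_col A) v) =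
      (\<lambda>i. if i < m then \<Sum>l<n. B i l * v l else 0)" for v
    using result_mult_sparse[of A n v] by simp
  have G0: "P 1 l = a 1 * ((\<Sum>i<m. B i l * (\<Sum>l<n. B i l * x0 $ l)) - 1)" for l
    using mult_index[OF x0_carrier]
    by (auto simp: P_1 G_def start simp del: index_mult_mat_vec intro!: sum.cong)
  have p: "st_p st = (\<lambda>l. if l < n then P 1 l else 0)"
    by (simp add: st_def lazy_init_def result_simps result_loop result_dot_col fold_store mult step_1 G0
        cong: if_cong del: One_nat_def)
  have st_x: "st_x st = (\<lambda>l. if l < n then x 1 $ l else 0)"
  proof -
    have "st_x st = (\<lambda>l. if l < n then clip (lam l) (x0 $ l) (st_p st l) else 0)"
      by (simp add: st_def lazy_init_def result_simps result_loop result_prox fold_store cong: if_cong)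
    then show ?thesis by (auto simp: p lam x_clip)
  qed
  have Ax: "st_Ax st = (\<lambda>i. if i < m then \<Sum>l<n. B i l * st_x st l else 0)"
    by (simp add: st_def lazy_init_def result_simps mult cong: if_cong)
  have d: "st_d st = (\<lambda>i. if i < m then st_Ax st i - (\<Sum>l<n. B i l * x0 $ l) else 0)"
    by (simp add: st_def lazy_init_def result_simps result_loop fold_store mult fun_eq_iff)
  have "st_r st = (\<lambda>_. 0)" "st_s st = (\<lambda>_. 0)" "st_supp st = [0..<m]" "st_a st = a 1"
    "st_S st = S 1" "st_S' st = S 0"
    by (simp_all add: st_def lazy_init_def result_simps step_1 del: One_nat_def)
  then show ?thesis
    using AT_1 start p st_x Ax d unfolding st_def[symmetric] Inv_def by (simp add: AX_def)
qed

lemma Inv_step: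
  assumes inv: "Inv (k - 1) st" and k: "k \<ge> 2"
  shows "Inv k (result (lazy_step n (sparse_col A) lam (($) x0) k (j k) st))"
proof -
  define k' where "k' = k - 1"
  have k': "k = k' + 1" "k' \<ge> 1" using k by (auto simp: k'_def)
  note inv = inv[folded k'_def, unfolded Inv_def]
  have jn: "j k < n" using j k by simp
  have a': "result (next_step_size n k st) = a k"
  proof (cases "k = 2")
    case True
    then show ?thesis using inv k'
      by (simp add: next_step_size_def result_simps numeral_2_eq_2 step_size.simps(3))
  next
    case False
    then obtain r where "k = Suc (Suc (Suc r))"
      using k by (metis One_nat_def Suc_1 add_2_eq_Suc le_Suc_ex not0_implies_Suc add.right_neutral)
    then show ?thesis using False inv k'
      by (simp add: next_step_size_def result_simps step_size.simps(4))
  qed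
  obtain ws wd where w: "result (extrapolation n k st (a k)) = (ws, wd)" by fastforce
  have pos: "a k > 0" "S k > 0" "a k' > 0" "S k' > 0" using step_pos[OF n2] k' by auto
  have yb: "st_Ax st i + ws * st_s st i + wd * st_d st i = yb k' $ i" if i: "i < m" for i
  proof (cases "k = 2")
    case True
    then have "k' = 1" using k' by simp
    then have "yb k' $ i = AX 1 i + a 1 / a 2 * (AX 1 i - AX 0 i)"
      using yb_index[of 1 i] y_index(1)[of 1 i] y_index(2)[of i] i AT_1 by (simp add: numeral_2_eq_2)
    moreover have "ws = 1 / S 1" "wd = a 1 / a 2"
      using w True inv \<open>k' = 1\<close> by (simp_all add: extrapolation_def result_simps)
    ultimately show ?thesis using inv i \<open>k' = 1\<close> AT_1[of i] by simp
  next
    case False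
    then have k'2: "k' \<ge> 2" "k' - 1 \<ge> 1" using k k' by auto
    define q where "q = a k' / a k * (a k' / S (k' - 1))"
    have S1: "S (k' - 1) > 0" using step_pos[OF n2 k'2(2)] by simp
    have Sk': "S k' = S (k' - 1) + a k'" using step_sum_Suc[of n "k' - 1"] k'2 by simp
    have ws: "ws = (1 - q) / S k'" and wd: "wd = q * (real n - 1)"
      using w False inv by (simp_all add: extrapolation_def result_simps q_def)
    have "S (k' - 1) * (AT k' i - AT (k' - 1) i) =
        a k' * ((real n - 1) * (AX k' i - AX (k' - 1) i) - (AT k' i - AX k' i))"
      using AT_rec[OF k'2(1), of i] unfolding Sk' by (simp add: algebra_simps)
    then have diff: "AT k' i - AT (k' - 1) i =
        a k' / S (k' - 1) * ((real n - 1) * (AX k' i - AX (k' - 1) i) - (AT k' i - AX k' i))"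
      using S1 by (simp add: field_simps)
    have "yb k' $ i = AT k' i + a k' / a k * (AT k' i - AT (k' - 1) i)"
      using yb_index[OF k'(2) i] y_index(1)[OF k'(2) i] y_index(1)[OF k'2(2) i] k' by simp
    also have "\<dots> = AT k' i + q * ((real n - 1) * (AX k' i - AX (k' - 1) i) - (AT k' i - AX k' i))"
      unfolding diff q_def by simp
    also have "\<dots> = AX k' i + (1 - q) * (AT k' i - AX k' i) + wd * (AX k' i - AX (k' - 1) i)"
      unfolding wd by (simp add: algebra_simps)
    also have "(1 - q) * (AT k' i - AX k' i) = ws * (S k' * (AT k' i - AX k' i))"
      using pos by (simp add: ws)
    finally show ?thesis using inv i by simp
  qed
  have g: "result (dot_extrapolated (sparse_col A (j k)) (ws, wd) st) - 1 = G (yb k') (j k)"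
  proof -
    let ?F = "\<lambda>i v. v * (st_Ax st i + ws * st_s st i + wd * st_d st i)"
    have "(\<Sum>i<m. ?F i (B i (j k))) = (\<Sum>i<m. B i (j k) * yb k' $ i)"
      using yb by (intro sum.cong) auto
    then show ?thesis
      using fold_sum[of ?F "sparse_col A (j k)" 0] sum_sparse_col[of ?F A "j k"]
      by (simp add: dot_extrapolated_def result_loop result_simps case_prod_unfold G_def)
  qed
  define st' where "st' = result (lazy_step n (sparse_col A) lam (($) x0) k (j k) st)"
  have P: "st_p st (j k) + real n * a k * G (yb k') (j k) = P k (j k)"
    using P_rec[OF k, of "j k"] inv jn by (simp add: k'_def)
  define z where "z = x k $ j k"
  define dx where "dx = z - x k' $ j k"
  define h where "h = ((real n - 1) * a k - S k') * dx"
  have z: "clip (lam (j k)) (x0 $ j k) (P k (j k)) = z"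
    using x_clip[of k "j k"] k jn by (simp add: lam z_def)
  note fst' = lazy_step_def result_simps a' w g P result_prox z result_add_col result_loop fst_conv snd_conv
  have st':
    "st_x st' = (st_x st)(j k := z)" "st_p st' = (st_p st)(j k := P k (j k))"
    "st_r st' = (st_r st)(j k := st_r st (j k) + h)"
    "st_s st' = (\<lambda>i. st_s st i + (if i < m then B i (j k) * h else 0))"
    "st_Ax st' = (\<lambda>i. st_Ax st i + (if i < m then B i (j k) * dx else 0))"
    "st_d st' = (\<lambda>i. (if i \<in> set (st_supp st) then 0 else st_d st i) + (if i < m then B i (j k) * dx else 0))"
    "st_supp st' = map fst (sparse_col A (j k))" "st_a st' = a k" "st_S st' = S k' + a k" "st_S' st' = S k'"
    using inv jn P fold_store[of "\<lambda>_. 0" "st_supp st" "st_d st"]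
    by (simp_all add: st'_def fst' h_def dx_def cong: if_cong)
  have Sk: "S k = S k' + a k" using step_sum_Suc[of n k'] k' by simp
  have dx0: "AX k i = AX k' i + B i (j k) * dx" for i
    using AX_rec[OF k, of i] by (simp add: dx_def z_def k'_def)
  have r: "S k * (xt k $ l - x k $ l) = S k' * (xt k' $ l - x k' $ l) +
      ((real n - 1) * a k - S k') * (x k $ l - x k' $ l)" if "l < n" for l
    using xt_index[OF k that] Sk by (simp add: k'_def algebra_simps)
  have s: "S k * (AT k i - AX k i) = S k' * (AT k' i - AX k' i) +
      ((real n - 1) * a k - S k') * (AX k i - AX k' i)" for i
    using AT_rec[OF k, of i] Sk by (simp add: k'_def algebra_simps)
  have x_eq: "x k $ l = x k' $ l" "P k l = P k' l" if "l < n" "l \<noteq> j k" for l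
    using x_unchanged[OF k that] P_rec[OF k, of l] that by (simp_all add: k'_def)
  have "st_x st' l = x k $ l \<and> st_r st' l = S k * (xt k $ l - x k $ l) \<and> st_p st' l = P k l"
    if "l < n" for l
    using inv that x_eq[of l] r[OF that] by (auto simp: st' z_def h_def dx_def)
  moreover have "st_Ax st' i = AX k i \<and> st_s st' i = S k * (AT k i - AX k i) \<and>
      st_d st' i = AX k i - AX k' i \<and> (i \<notin> set (st_supp st') \<longrightarrow> st_d st' i = 0)"
    if "i < m" for i
  proof -
    have "B i (j k) = 0" if "i \<notin> set (map fst (sparse_col A (j k)))"
      using that \<open>i < m\<close> by (auto simp: sparse_col_def image_image)
    then show ?thesis
      using inv that dx0[of i] s[of i] by (auto simp: st' h_def k'_def[symmetric])
  qed
  ultimately show ?thesis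
    using st'(8-10) unfolding st'_def[symmetric] Inv_def k'_def[symmetric] Sk[symmetric] by blast
qed

lemma result_lazy_run_aux:
  assumes K: "K \<ge> 1"
  shows "result (lazy_run A x0 j K) = xt K"
proof -
  define st where "st K = result (loop (\<lambda>k st. lazy_step n (sparse_col A) lam (($) x0) k (j k) st) [2..<Suc K]
      (result (lazy_init m n (sparse_col A) lam (($) x0))))" for K
  have "Inv K (st K)"
    using K
  proof (induction K rule: dec_induct)
    case base
    then show ?case using Inv_init by (simp add: st_def result_simps)
  next
    case (step k)
    then show ?case using Inv_step[of "Suc k" "st k"] by (simp add: st_def result_loop)
  qed
  then have "st_r (st K) l / st_S (st K) + st_x (st K) l = xt K $ l" if "l < n" for l
    using step_pos[OF n2 K] that by (simp add: Inv_def)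
  moreover have "result (lazy_run A x0 j K) =
      vec n (\<lambda>l. st_x (st K) l + st_r (st K) l / st_S (st K))"
    by (auto simp: lazy_run_def Let_def result_simps result_loop st_def fold_store simp del: upt_Suc)
  ultimately show ?thesis
    using xt_carrier[OF K] by (auto simp: add.commute)
qed

end

text \<open>The output of the lazy implementation is the output of SI-NNLS+.\<close>

theorem result_lazy_run:
  assumes "nonneg_nondegenerate A" "dim_col A \<ge> 2" "\<And>k. k \<ge> 1 \<Longrightarrow> j k < dim_col A"
    "x0 \<in> nnls_box A" "si_nnls_plus A x0 j x y yb xt" "K \<ge> 1"
  shows "result (lazy_run A x0 j K) = xt K"
  using assms
  by (intro si_nnls_plus_run.result_lazy_run_aux[of A "dim_row A" "dim_col A"] si_nnls_plus_run.intro) auto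

end

theory Submission
  imports Defs
begin

text \<open>
  Write $\Lambda$ for the diagonal matrix of squared column norms. For $k \ge 1$ the dual
  iterate is $y_k = A \widetilde{x}_k$, and $\overline{y}_k$ is its extrapolation. The proof compares one run of the method
  with a fixed point $u$ of the box and follows four quantities: the scaled gap
  $A_k (f(\widetilde{x}_k) - f(u))$, the gap $\phi_k(u) - \phi_k(x_k)$ of the primal model, the cross
  term $T_k = a_k \langle y_k - y_{k-1}, A (x_k - u) \rangle$, and
  $n^2 a_k^2 \|y_k - y_{k-1}\|^2$.

  \<^item> The scaled gap grows by at most
    $a_k \langle A^T y_k - 1, w_k - u \rangle - \frac12 A_{k-1} \|y_k - y_{k-1}\|^2$, where
    $w_k = n x_k - (n - 1) x_{k-1}$ is the point that enters the average
    (\<open>dual_gap_step\<close>), because $f$ is a maximum of functions that are affine in the primal and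
    strongly concave in the dual variable.
  \<^item> The primal model is strongly convex in $\|\cdot\|_\Lambda$ and only its sampled coordinate
    changes, so its gap pays $\frac12 \|x_k - x_{k-1}\|_\Lambda^2$ and receives the sampled partial
    derivative at $\overline{y}_{k-1}$ times $n a_k (u - x_k)_{j_k}$ (\<open>primal_gap_step\<close>). Up to a
    term that vanishes when it is averaged over the sample, this product is
    $- a_k \langle A^T \overline{y}_{k-1} - 1, w_k - u \rangle$.
  \<^item> What remains is $a_k \langle y_k - \overline{y}_{k-1}, A (w_k - u) \rangle$. The extrapolation
    is chosen so that this is $T_k - T_{k-1}$ plus products of dual moves with
    $A (x_k - x_{k-1})$. As a single coordinate moves, $\|A (x_k - x_{k-1})\| =
    \|x_k - x_{k-1}\|_\Lambda$, and Young's inequality together with $4 n^2 a_k^2 \le A_{k-1}$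
    absorbs these products.

  Thus the sum of the scaled gap, the model gap, $- T_k$ and the last quantity increases by mean-zero
  noise only (\<open>potential_step\<close>). It starts below $\phi_0(u)$, by the choice of $a_1$, and the
  model gap dominates what is left of $T_k$ at the end. This gives \<open>gap_le_noise\<close>, and taking
  expectations gives \<open>expected_gap\<close>. A minimiser over the orthant lies in the box because $A$ is
  nonnegative, so it may serve as $u$. The bound with the gradient costs only a factor 2: the output
  is nonnegative, hence $f(\widetilde{x}) - f(x^\star) \ge \frac12 \|A (\widetilde{x} - x^\star)\|^2$,
  while $\langle \nabla f(\widetilde{x}), \widetilde{x} - x^\star \rangle$ exceeds the gap in $f$ by
  exactly $\frac12 \|A (\widetilde{x} - x^\star)\|^2$.

  The sums $A_k$ grow by the factor $n / (n - 1)$ per step until they reach $((n - 1) / (2 n))^2$,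
  which takes at most $\frac52 n \log n$ steps; from then on $\sqrt{A_k}$ grows by at least
  $1 / (6 n)$ per step. As for the cost, an iteration takes time proportional to the number of nonzeros
  of the sampled column, which is $\mathrm{nnz}(A) / n$ on average, and there are
  $O(n \log n + n / \sqrt\epsilon)$ iterations.
\<close>

section \<open>Step sizes\<close>

lemma step_size_1_sq:
  assumes "n \<ge> 1"
  shows "2 * real n ^ 3 * (step_size n 1)\<^sup>2 = 1"
proof -
  have "(real n powr (3/2))\<^sup>2 = real n ^ 3"
    using assms by (simp add: powr_power)
  then show ?thesis
    using assms by (simp add: step_size.simps(2) power_divide power_mult_distrib)
qed

lemma step_size_1_le:
  assumes "n \<ge> 4"
  shows "step_size n 1 \<le> 1/8"
proof -
  have "real 4 ^ 3 \<le> real n ^ 3" using assms by (intro power_mono) auto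
  then have "128 * (step_size n 1)\<^sup>2 \<le> 2 * real n ^ 3 * (step_size n 1)\<^sup>2"
    by (intro mult_right_mono) auto
  also have "\<dots> = 1" using step_size_1_sq[of n] assms by simp
  finally have "(step_size n 1)\<^sup>2 \<le> (1/8)\<^sup>2"
    by (simp add: power2_eq_square)
  then show ?thesis by (rule power2_le_imp_le) simp
qed

lemma step_size_2: "step_size n 2 = step_size n 1 / (real n - 1)"
  using step_size.simps(3)[of n] by (simp add: numeral_2_eq_2)

lemma step_sum_1: "step_sum n 1 = step_size n 1"
  by (simp add: step_sum.simps)

lemma step_size_rec:
  "k \<ge> 3 \<Longrightarrow> step_size n k =
     min (real n * step_size n (k - 1) / (real n - 1)) (sqrt (step_sum n (k - 1)) / (2 * real n))"
  using step_size.simps(4)[of n "k - 3"] by (simp add: numeral_3_eq_3 Suc_diff_Suc)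

lemma step_sum_rec: "k \<ge> 1 \<Longrightarrow> step_sum n k = step_sum n (k - 1) + step_size n k"
  using step_sum_Suc[of n "k - 1"] by simp

text \<open>Together with $a_1 = (n - 1) a_2$, the ratio bound makes the output a nonnegative combination
  of the iterates: $x_k$ enters the average with weight $n a_k - (n - 1) a_{k+1}$.\<close>

lemma step_size_growth:
  assumes "n \<ge> 4" "k \<ge> 1"
  shows "(real n - 1) * step_size n (k + 1) \<le> real n * step_size n k"
proof (cases "k = 1")
  case True
  have "step_size n 1 * 1 \<le> step_size n 1 * real n"
    using step_pos[of n 1] assms by (intro mult_left_mono) auto
  then show ?thesis
    using True assms step_size_2[of n] by (simp add: numeral_2_eq_2 mult.commute)
next
  case False
  then have "step_size n (k + 1) \<le> real n * step_size n k / (real n - 1)"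
    using assms step_size_rec[of "k + 1" n] by simp
  then show ?thesis using assms by (simp add: field_simps)
qed

text \<open>The relation between step size and sum under which Young's inequality closes the potential
  argument. The square root branch of the recursion enforces it for $k \ge 3$; for $k = 2$ it rests
  on the smallness of $a_1$.\<close>

lemma step_size_sq_le:
  assumes "n \<ge> 4" "k \<ge> 2"
  shows "4 * (real n)\<^sup>2 * (step_size n k)\<^sup>2 \<le> step_sum n (k - 1)"
proof (cases "k = 2")
  case True
  let ?a = "step_size n 1"
  have a: "0 < ?a" "?a \<le> 1/8" using step_pos[of n 1] step_size_1_le assms by auto
  have n: "4 * (real n - 1) \<ge> 3 * real n" using assms by simp
  have "real n * step_size n 2 \<le> 4/3 * ?a"
  proof -
    have "real n * ?a * 3 \<le> 4 * ?a * (real n - 1)"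
      using mult_left_mono[OF n, of ?a] a by (simp add: algebra_simps)
    then show ?thesis using assms by (simp add: step_size_2 field_simps)
  qed
  then have "(real n * step_size n 2)\<^sup>2 \<le> (4/3 * ?a)\<^sup>2"
    using step_pos[of n 2] assms by (intro power_mono) auto
  also have "\<dots> \<le> ?a / 4" using mult_left_mono[OF a(2), of ?a] a by (simp add: power2_eq_square)
  finally show ?thesis using True by (simp add: step_sum_1[simplified] power_mult_distrib)
next
  case False
  then have "step_size n k \<le> sqrt (step_sum n (k - 1)) / (2 * real n)"
    using assms step_size_rec[of k n] by simp
  then have "(2 * real n) * step_size n k \<le> sqrt (step_sum n (k - 1))"
    using assms by (simp add: field_simps)
  then have "((2 * real n) * step_size n k)\<^sup>2 \<le> (sqrt (step_sum n (k - 1)))\<^sup>2"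
    using step_pos[of n k] assms by (intro power_mono) auto
  also have "k - 1 \<ge> 1" using assms by simp
  then have "(sqrt (step_sum n (k - 1)))\<^sup>2 = step_sum n (k - 1)"
    using step_pos[of n "k - 1"] assms by simp
  finally show ?thesis by (simp add: power_mult_distrib)
qed

text \<open>Eliminates the previous step size from the recursion. In the geometric phase
  $a_{k-1} = A_{k-2} / (n - 1)$, and multiplying by $n / (n - 1)$ turns this into
  $A_{k-1} / (n - 1)$. In the square root phase $A_{k-1} \le \frac{n}{n-1} A_{k-2}$, so
  $\frac{n}{n-1} a_{k-1}$ stays above $\sqrt{A_{k-1}} / (2 n)$.\<close>

lemma step_size_ge:
  assumes "n \<ge> 4" "k \<ge> 2"
  shows "step_size n k \<ge> min (step_sum n (k - 1) / (real n - 1)) (sqrt (step_sum n (k - 1)) / (2 * real n))"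
  using assms(2)
proof (induction k rule: dec_induct)
  case base
  then show ?case by (simp add: step_size_2 step_sum_1[simplified])
next
  case (step k)
  let ?S' = "step_sum n (k - 1)" and ?S = "step_sum n k" and ?a = "step_size n k" and ?N = "real n - 1"
  have S: "?S = ?S' + ?a" using step_sum_rec[of k n] step.hyps by simp
  have pos: "?S' > 0" "?a > 0" "?S > 0" "?N > 0"
    using step_pos[of n k] step_pos[of n "k - 1"] assms step.hyps by auto
  have "real n * ?a / ?N \<ge> min (?S / ?N) (sqrt ?S / (2 * real n))"
  proof (cases "?a \<ge> ?S' / ?N")
    case True
    then have "?S' \<le> ?a * ?N" using pos by (simp add: field_simps)
    then have "?S \<le> real n * ?a" using S by (simp add: algebra_simps)
    then have "?S / ?N \<le> real n * ?a / ?N" using pos by (intro divide_right_mono) auto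
    then show ?thesis by simp
  next
    case False
    then have a: "?a \<ge> sqrt ?S' / (2 * real n)" using step.IH by linarith
    have "?a * ?N < ?S'" using False pos by (simp add: field_simps)
    then have "?S * ?N \<le> real n * ?S'" by (simp add: S algebra_simps)
    then have "?S \<le> real n / ?N * ?S'" using pos by (simp add: field_simps)
    also have "\<dots> \<le> (real n / ?N)\<^sup>2 * ?S'"
      using pos by (intro mult_right_mono self_le_power) auto
    finally have "sqrt ?S \<le> sqrt ((real n / ?N)\<^sup>2 * ?S')" by simp
    also have "\<dots> = real n / ?N * sqrt ?S'" using pos by (simp add: real_sqrt_mult)
    finally have "sqrt ?S / (2 * real n) \<le> real n / ?N * sqrt ?S' / (2 * real n)"
      by (rule divide_right_mono) simp
    also have "\<dots> = real n / ?N * (sqrt ?S' / (2 * real n))" by simp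
    also have "\<dots> \<le> real n / ?N * ?a" using a pos by (intro mult_left_mono) auto
    finally show ?thesis by simp
  qed
  then show ?case using step_size_rec[of "Suc k" n] step.hyps by simp
qed

text \<open>Below the threshold $((n - 1) / (2 n))^2$ the first argument of the minimum in \<open>step_size_ge\<close>
  is the smaller one, and each step multiplies the sum by at least $n / (n - 1)$.\<close>

lemma step_sum_geometric:
  assumes "n \<ge> 4" "k \<ge> 1"
  shows "step_sum n k \<ge> min (((real n - 1) / (2 * real n))\<^sup>2) (step_size n 1 * (real n / (real n - 1)) ^ (k - 1))"
  using assms(2)
proof (induction k rule: dec_induct)
  case base
  then show ?case by (simp add: step_sum_1[simplified])
next
  case (step k)
  let ?S = "step_sum n k" and ?N = "real n - 1"
  have pos: "?S > 0" "?N > 0" "step_size n (Suc k) > 0"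
    using step_pos[of n k] step_pos[of n "Suc k"] assms step.hyps by auto
  have rec: "step_sum n (Suc k) = ?S + step_size n (Suc k)" by (rule step_sum_Suc)
  show ?case
  proof (cases "?S \<ge> (?N / (2 * real n))\<^sup>2")
    case True
    then show ?thesis using rec pos by linarith
  next
    case False
    have "sqrt ?S \<le> ?N / (2 * real n)"
      using False pos by (intro real_le_lsqrt) auto
    then have "sqrt ?S * sqrt ?S \<le> ?N / (2 * real n) * sqrt ?S" using pos by (intro mult_right_mono) auto
    then have "?S / ?N \<le> sqrt ?S / (2 * real n)" using pos by (simp add: field_simps)
    then have "step_size n (Suc k) \<ge> ?S / ?N"
      using step_size_ge[of n "Suc k"] assms step.hyps by simp
    then have "step_sum n (Suc k) \<ge> ?S * (real n / ?N)"
      using rec pos by (simp add: field_simps)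
    moreover have "?S * (real n / ?N) \<ge> step_size n 1 * (real n / ?N) ^ (k - 1) * (real n / ?N)"
      using step.IH False pos by (intro mult_right_mono) auto
    moreover have "(real n / ?N) ^ (k - 1) * (real n / ?N) = (real n / ?N) ^ (Suc k - 1)"
      using step.hyps by (cases k) auto
    ultimately have "step_size n 1 * (real n / ?N) ^ (Suc k - 1) \<le> step_sum n (Suc k)"
      by (metis mult.assoc order_trans)
    then show ?thesis by (rule min.coboundedI2)
  qed
qed

lemma ln_ge_1: "n \<ge> 4 \<Longrightarrow> ln (real n) \<ge> 1"
proof -
  assume "n \<ge> 4"
  then have "exp 1 \<le> real n" using e_less_272 by simp
  then show ?thesis using \<open>n \<ge> 4\<close> by (simp add: ln_ge_iff)
qed

text \<open>As $\ln (n / (n - 1)) \ge 1 / n$, already $\frac32 n \ln n + 1$ steps multiply $a_1$ by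
  $n^{3/2}$, which gives $1 / \sqrt2$. The remaining $n \ln n - 1$ steps are slack.\<close>

lemma step_sum_large:
  assumes n: "n \<ge> 4" and k: "real k \<ge> 5/2 * real n * ln (real n)"
  shows "step_sum n k \<ge> ((real n - 1) / (2 * real n))\<^sup>2"
proof -
  let ?q = "real n / (real n - 1)"
  have ln: "ln (real n) \<ge> 1" using ln_ge_1 n by simp
  have "5/2 * real n * 1 \<le> 5/2 * real n * ln (real n)" using ln by (intro mult_left_mono) auto
  then have k10: "real k \<ge> 10" using k n by linarith
  have "real n * ln (real n) \<ge> real n * 1" using ln by (intro mult_left_mono) auto
  then have "3/2 * (real n * ln (real n)) \<le> real k - 1"
    using k n by linarith
  then have "3/2 * ln (real n) \<le> (real k - 1) * (1 / real n)"
    using n by (simp add: field_simps)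
  also have "ln ?q \<ge> 1 / real n"
    using ln_add_one_self_le_self2[of "- 1 / real n"] n by (simp add: ln_div field_simps)
  then have "(real k - 1) * (1 / real n) \<le> (real k - 1) * ln ?q"
    using k10 by (intro mult_left_mono) auto
  also have "real k - 1 = real (k - 1)" using k10 by (simp add: of_nat_diff)
  finally have "3/2 * ln (real n) \<le> real (k - 1) * ln ?q" .
  then have "exp (3/2 * ln (real n)) \<le> exp (real (k - 1) * ln ?q)" by simp
  then have "real n powr (3/2) \<le> ?q ^ (k - 1)"
    using n by (simp add: powr_def exp_of_nat_mult)
  then have "step_size n 1 * ?q ^ (k - 1) \<ge> step_size n 1 * real n powr (3/2)"
    using step_pos[of n 1] n by (intro mult_left_mono) auto
  moreover have "step_size n 1 * real n powr (3/2) = 1 / sqrt 2"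
    using n by (simp add: step_size.simps(2))
  moreover have "1 / sqrt 2 \<ge> 1 / (2::real)"
    by (intro divide_left_mono) (auto intro: real_le_lsqrt)
  moreover have "((real n - 1) / (2 * real n))\<^sup>2 \<le> (1/2)\<^sup>2"
    using n by (intro power_mono) (auto simp: field_simps)
  moreover have "(1/2)\<^sup>2 = (1/4::real)" by (simp add: power2_eq_square)
  ultimately have "((real n - 1) / (2 * real n))\<^sup>2 \<le> step_size n 1 * ?q ^ (k - 1)"
    by linarith
  then show ?thesis using step_sum_geometric[of n k] n k10 by simp
qed

text \<open>A discrete form of $\frac{d}{dk} \sqrt{A} = \frac{A'}{2 \sqrt A} \ge \frac{1}{4 n}$. The
  smaller constant $1 / (6 n)$ leaves room for the square of the increment.\<close>

lemma sqrt_step_sum_increment: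
  assumes n: "n \<ge> 4" and k: "k \<ge> 1" and S: "step_sum n k \<ge> ((real n - 1) / (2 * real n))\<^sup>2"
  shows "sqrt (step_sum n (Suc k)) \<ge> sqrt (step_sum n k) + 1 / (6 * real n)"
proof -
  let ?s = "sqrt (step_sum n k)" and ?N = "real n - 1"
  have pos: "step_sum n k > 0" using step_pos[of n k] n k by simp
  have s2: "?s * ?s = step_sum n k" using pos by simp
  have s: "?s \<ge> ?N / (2 * real n)" using S n by (intro real_le_rsqrt) auto
  have "?N / (2 * real n) \<ge> 1 / (6 * real n)" using n by (simp add: field_simps)
  then have s': "?s \<ge> 1 / (6 * real n)" using s by linarith
  have "?N / (2 * real n) * ?s \<le> ?s * ?s" using s pos by (intro mult_right_mono) auto
  then have "?s / (2 * real n) \<le> step_sum n k / ?N" using n s2 by (simp add: field_simps)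
  then have "step_size n (Suc k) \<ge> ?s / (2 * real n)" using step_size_ge[of n "Suc k"] n k by simp
  then have "step_sum n (Suc k) \<ge> ?s * ?s + ?s / (2 * real n)" using s2 by (simp add: step_sum_Suc)
  moreover have "(?s + 1 / (6 * real n))\<^sup>2 = ?s * ?s + ?s / (3 * real n) + 1 / (6 * real n) * (1 / (6 * real n))"
    using n by (simp add: power2_eq_square field_simps)
  moreover have "1 / (6 * real n) * (1 / (6 * real n)) \<le> ?s * (1 / (6 * real n))"
    using s' by (intro mult_right_mono) auto
  moreover have "?s / (3 * real n) + ?s * (1 / (6 * real n)) = ?s / (2 * real n)"
    using n by (simp add: field_simps)
  ultimately have "(?s + 1 / (6 * real n))\<^sup>2 \<le> step_sum n (Suc k)" by linarith
  then show ?thesis by (intro real_le_rsqrt)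
qed

theorem step_sum_lower_bound:
  assumes n: "n \<ge> 4" and K: "real K \<ge> 5/2 * real n * ln (real n)"
  shows "step_sum n K \<ge> (real K - 5/2 * real n * ln (real n))\<^sup>2 / (36 * (real n)\<^sup>2)"
proof -
  define c where "c = 5/2 * real n * ln (real n)"
  have "real n * ln (real n) \<ge> real n * 1" using ln_ge_1 n by (intro mult_left_mono) auto
  moreover have "c = 5/2 * (real n * ln (real n))" by (simp add: c_def)
  ultimately have c: "c \<ge> 1" using n by linarith
  define K0 where "K0 = nat \<lceil>c\<rceil>"
  have K0: "real K0 \<ge> c" "real K0 < c + 1" using c by (auto simp: K0_def) linarith
  have "K0 \<le> K" using K unfolding K0_def c_def by (simp add: ceiling_le_iff nat_le_iff)
  then have "sqrt (step_sum n K) \<ge> (real K - c) / (6 * real n)"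
  proof (induction K rule: dec_induct)
    case base
    \<comment> \<open>rounding \<open>c\<close> up costs less than one step, which the threshold value covers\<close>
    have "(real K0 - c) / (6 * real n) \<le> 1 / (6 * real n)"
      using K0 by (intro divide_right_mono) auto
    also have "\<dots> \<le> (real n - 1) / (2 * real n)"
      using n by (simp add: field_simps)
    also have "\<dots> \<le> sqrt (step_sum n K0)"
      using step_sum_large[of n K0] n K0 by (intro real_le_rsqrt) (auto simp: c_def)
    finally show ?case .
  next
    case (step k)
    have k: "real k \<ge> c" "k \<ge> 1" using step.hyps K0 c by linarith+
    have "(real (Suc k) - c) / (6 * real n) = (real k - c) / (6 * real n) + 1 / (6 * real n)"
      by (simp add: add_divide_distrib[symmetric])
    then show ?case
      using step.IH sqrt_step_sum_increment[of n k] step_sum_large[of n k] n k by (simp add: c_def)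
  qed
  then have "((real K - c) / (6 * real n))\<^sup>2 \<le> (sqrt (step_sum n K))\<^sup>2"
    using K by (intro power_mono) (auto simp: c_def)
  also have "\<dots> = step_sum n K" using step_pos[of n K] n K0 c \<open>K0 \<le> K\<close> by simp
  finally show ?thesis by (simp add: c_def power_divide power_mult_distrib)
qed

section \<open>The least squares objective\<close>

text \<open>The partial derivative of $\langle A x, v \rangle - 1^T x$ in $x_l$. At $v = A z$ it is that of
  the objective at \<open>z\<close>.\<close>

definition residual :: "real mat \<Rightarrow> real vec \<Rightarrow> nat \<Rightarrow> real" where
  "residual A v l = (\<Sum>i<dim_row A. A $$ (i, l) * v $ i) - 1"

abbreviation nnls_grad :: "real mat \<Rightarrow> real vec \<Rightarrow> nat \<Rightarrow> real" where
  "nnls_grad A z \<equiv> residual A (A *\<^sub>v z)"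

definition image_sq_dist :: "real mat \<Rightarrow> real vec \<Rightarrow> real vec \<Rightarrow> real" where
  "image_sq_dist A z w = (\<Sum>i<dim_row A. ((A *\<^sub>v z) $ i - (A *\<^sub>v w) $ i)\<^sup>2)"

lemma mat_vec_index_sum:
  "z \<in> carrier_vec (dim_col A) \<Longrightarrow> i < dim_row A \<Longrightarrow> (A *\<^sub>v z) $ i = (\<Sum>l<dim_col A. A $$ (i, l) * z $ l)"
  by (auto simp: scalar_prod_def atLeast0LessThan intro!: sum.cong)

lemma nnls_obj_sum:
  assumes "z \<in> carrier_vec (dim_col A)"
  shows "nnls_obj A z = (\<Sum>i<dim_row A. ((A *\<^sub>v z) $ i)\<^sup>2) / 2 - (\<Sum>l<dim_col A. z $ l)"
proof -
  have "ones (dim_col A) \<bullet> z = (\<Sum>l<dim_col A. z $ l)"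
    using assms unfolding ones_def scalar_prod_def by (auto simp: atLeast0LessThan intro!: sum.cong)
  moreover have "sq_norm (A *\<^sub>v z) = (\<Sum>i<dim_row A. ((A *\<^sub>v z) $ i)\<^sup>2)"
    unfolding sq_norm_def scalar_prod_def
    by (simp add: power2_eq_square atLeast0LessThan del: index_mult_mat_vec)
  ultimately show ?thesis by (simp add: nnls_obj_def)
qed

lemma sum_nnls_grad:
  assumes "d \<in> carrier_vec (dim_col A)"
  shows "(\<Sum>l<dim_col A. nnls_grad A z l * d $ l) =
    (\<Sum>i<dim_row A. (A *\<^sub>v z) $ i * (A *\<^sub>v d) $ i) - (\<Sum>l<dim_col A. d $ l)"
proof -
  have "(\<Sum>l<dim_col A. nnls_grad A z l * d $ l) =
      (\<Sum>l<dim_col A. \<Sum>i<dim_row A. A $$ (i, l) * (A *\<^sub>v z) $ i * d $ l) - (\<Sum>l<dim_col A. d $ l)"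
    by (simp add: residual_def left_diff_distrib sum_subtractf sum_distrib_right del: index_mult_mat_vec)
  also have "(\<Sum>l<dim_col A. \<Sum>i<dim_row A. A $$ (i, l) * (A *\<^sub>v z) $ i * d $ l) =
      (\<Sum>i<dim_row A. (A *\<^sub>v z) $ i * (A *\<^sub>v d) $ i)"
    by (subst sum.swap) (simp add: mat_vec_index_sum[OF assms] sum_distrib_left mult_ac del: index_mult_mat_vec)
  finally show ?thesis .
qed

lemma nnls_obj_expansion:
  assumes z: "z \<in> carrier_vec (dim_col A)" and w: "w \<in> carrier_vec (dim_col A)"
  shows "nnls_obj A w = nnls_obj A z + (\<Sum>l<dim_col A. nnls_grad A z l * (w $ l - z $ l)) + image_sq_dist A z w / 2"
proof -
  have "(\<Sum>i<dim_row A. ((A *\<^sub>v w) $ i)\<^sup>2) = (\<Sum>i<dim_row A. ((A *\<^sub>v z) $ i)\<^sup>2 +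
      2 * ((A *\<^sub>v z) $ i * (A *\<^sub>v w) $ i - (A *\<^sub>v z) $ i * (A *\<^sub>v z) $ i) + ((A *\<^sub>v z) $ i - (A *\<^sub>v w) $ i)\<^sup>2)"
    by (intro sum.cong refl) (simp add: power2_eq_square algebra_simps)
  then show ?thesis
    unfolding nnls_obj_sum[OF z] nnls_obj_sum[OF w] right_diff_distrib sum_subtractf
      sum_nnls_grad[OF z] sum_nnls_grad[OF w] image_sq_dist_def
    by (simp add: sum.distrib sum_subtractf sum_distrib_left[symmetric] field_simps del: index_mult_mat_vec)
qed

lemma gradient_nnls_obj:
  assumes z: "z \<in> carrier_vec (dim_col A)" and l: "l < dim_col A"
  shows "gradient (nnls_obj A) z $ l = nnls_grad A z l"
proof -
  let ?n = "dim_col A" and ?e = "unit_vec (dim_col A) l :: real vec"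
  define q where "q = (\<Sum>i<dim_row A. ((A *\<^sub>v ?e) $ i)\<^sup>2)"
  have dim: "dim_vec z = ?n" using z by auto
  have "nnls_obj A (z + t \<cdot>\<^sub>v ?e) = nnls_obj A z + t * nnls_grad A z l + t\<^sup>2 * q / 2" for t
  proof -
    have c: "z + t \<cdot>\<^sub>v ?e \<in> carrier_vec ?n" using z by auto
    have "(\<Sum>k<?n. nnls_grad A z k * ((z + t \<cdot>\<^sub>v ?e) $ k - z $ k)) = (\<Sum>k<?n. if k = l then t * nnls_grad A z l else 0)"
      using dim l by (intro sum.cong refl) auto
    also have "\<dots> = t * nnls_grad A z l" using l by simp
    finally have 1: "(\<Sum>k<?n. nnls_grad A z k * ((z + t \<cdot>\<^sub>v ?e) $ k - z $ k)) = t * nnls_grad A z l" .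
    have "A *\<^sub>v (z + t \<cdot>\<^sub>v ?e) = A *\<^sub>v z + t \<cdot>\<^sub>v (A *\<^sub>v ?e)"
      using z by (subst mult_add_distrib_mat_vec[of A "dim_row A" ?n]) (auto simp: mult_mat_vec)
    then have 2: "image_sq_dist A z (z + t \<cdot>\<^sub>v ?e) = t\<^sup>2 * q"
      by (simp add: image_sq_dist_def q_def sum_distrib_left power_mult_distrib del: index_mult_mat_vec)
    show ?thesis unfolding nnls_obj_expansion[OF z c] 1 2 by simp
  qed
  moreover have "((\<lambda>t. nnls_obj A z + t * nnls_grad A z l + t\<^sup>2 * q / 2) has_field_derivative nnls_grad A z l) (at 0)"
    by (auto intro!: derivative_eq_intros)
  ultimately show ?thesis
    using l by (simp add: gradient_def dim DERIV_imp_deriv)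
qed

lemma gradient_scalar_prod:
  assumes z: "z \<in> carrier_vec (dim_col A)" and u: "u \<in> carrier_vec (dim_col A)"
  shows "gradient (nnls_obj A) z \<bullet> (z - u) = nnls_obj A z - nnls_obj A u + image_sq_dist A z u / 2"
proof -
  have "gradient (nnls_obj A) z \<bullet> (z - u) = (\<Sum>l<dim_col A. nnls_grad A z l * (z $ l - u $ l))"
    using z u by (auto simp: scalar_prod_def atLeast0LessThan gradient_nnls_obj intro!: sum.cong)
  moreover have "(\<Sum>l<dim_col A. nnls_grad A z l * (u $ l - z $ l)) = - (\<Sum>l<dim_col A. nnls_grad A z l * (z $ l - u $ l))"
    unfolding sum_negf[symmetric] by (intro sum.cong) (auto simp: algebra_simps)
  ultimately show ?thesis using nnls_obj_expansion[OF z u] by simp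
qed

text \<open>On the segment from \<open>u\<close> to \<open>z\<close> the objective changes by \<open>t\<close> times the sum in the claim plus a
  multiple of $t^2$, so a negative sum would contradict minimality for small \<open>t\<close>.\<close>

lemma variational_inequality:
  assumes u: "is_arg_min (nnls_obj A) (\<lambda>z. z \<in> nonneg_orthant (dim_col A)) u"
    and z: "z \<in> nonneg_orthant (dim_col A)"
  shows "(\<Sum>l<dim_col A. nnls_grad A u l * (z $ l - u $ l)) \<ge> 0"
proof (rule ccontr)
  let ?L = "\<Sum>l<dim_col A. nnls_grad A u l * (z $ l - u $ l)" and ?Q = "image_sq_dist A u z"
  assume neg: "\<not> ?L \<ge> 0"
  have uo: "u \<in> nonneg_orthant (dim_col A)" using u by (simp add: is_arg_min_def)
  have uc: "u \<in> carrier_vec (dim_col A)" and zc: "z \<in> carrier_vec (dim_col A)"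
    using uo z by (auto simp: nonneg_orthant_def)
  have Q: "?Q \<ge> 0" by (simp add: image_sq_dist_def sum_nonneg)
  \<comment> \<open>a step so short that the linear decrease dominates the quadratic term\<close>
  define t where "t = min 1 (- ?L / (?Q + 1))"
  have t: "0 < t" "t \<le> 1" "t * (?Q + 1) \<le> - ?L"
  proof -
    show "0 < t" using neg Q by (auto simp: t_def not_le intro!: divide_neg_pos)
    have "t \<le> - ?L / (?Q + 1)" by (simp add: t_def)
    then show "t * (?Q + 1) \<le> - ?L" using Q by (subst (asm) pos_le_divide_eq) auto
  qed (simp add: t_def)
  define w where "w = u + t \<cdot>\<^sub>v (z - u)"
  have wc: "w \<in> carrier_vec (dim_col A)" using uc zc by (auto simp: w_def)
  have w: "w $ l = (1 - t) * u $ l + t * z $ l" if "l < dim_col A" for l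
    using uc zc that by (simp add: w_def algebra_simps)
  have "w \<in> nonneg_orthant (dim_col A)"
    using wc w t uo z by (auto simp: nonneg_orthant_def intro!: add_nonneg_nonneg)
  then have "nnls_obj A u \<le> nnls_obj A w" using u by (auto simp: is_arg_min_def not_less)
  moreover have "(\<Sum>l<dim_col A. nnls_grad A u l * (w $ l - u $ l)) = t * ?L"
  proof -
    have "w $ l - u $ l = t * (z $ l - u $ l)" if "l < dim_col A" for l
      using w[OF that] by (simp add: algebra_simps)
    then show ?thesis by (simp add: sum_distrib_left mult.left_commute)
  qed
  moreover have "A *\<^sub>v w = A *\<^sub>v u + t \<cdot>\<^sub>v (A *\<^sub>v z - A *\<^sub>v u)"
    unfolding w_def using uc zc
    by (subst mult_add_distrib_mat_vec[of A "dim_row A" "dim_col A"])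
      (auto simp: mult_mat_vec[of A "dim_row A" "dim_col A"] mult_minus_distrib_mat_vec[of A "dim_row A" "dim_col A"])
  then have "image_sq_dist A u w = t * (t * ?Q)"
    by (simp add: image_sq_dist_def sum_distrib_left power2_eq_square algebra_simps del: index_mult_mat_vec)
  ultimately have "0 \<le> t * (?L + t * ?Q / 2)"
    using nnls_obj_expansion[OF uc wc] by (simp add: algebra_simps)
  then have "0 \<le> ?L + t * ?Q / 2" using t by (simp add: zero_le_mult_iff)
  moreover have "t * ?Q \<ge> 0" using t Q by simp
  ultimately show False using t neg by (simp add: algebra_simps)
qed

lemma quadratic_growth:
  assumes u: "is_arg_min (nnls_obj A) (\<lambda>z. z \<in> nonneg_orthant (dim_col A)) u"
    and z: "z \<in> nonneg_orthant (dim_col A)"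
  shows "nnls_obj A z - nnls_obj A u \<ge> image_sq_dist A z u / 2"
proof -
  have c: "u \<in> carrier_vec (dim_col A)" "z \<in> carrier_vec (dim_col A)"
    using u z by (auto simp: nonneg_orthant_def is_arg_min_def)
  have "image_sq_dist A z u = image_sq_dist A u z"
    by (simp add: image_sq_dist_def power2_commute del: index_mult_mat_vec)
  then show ?thesis using nnls_obj_expansion[OF c] variational_inequality[OF u z] by simp
qed

text \<open>Setting a positive coordinate $l$ of the minimiser to zero shows that its partial derivative
  is at most 0, so $\langle A_{:l}, A u \rangle \le 1$. As $A$ and $u$ are nonnegative,
  $\langle A_{:l}, A u \rangle \ge \|A_{:l}\|^2 u_l$.\<close>

lemma minimiser_in_box:
  assumes nd: "nonneg_nondegenerate A"
    and u: "is_arg_min (nnls_obj A) (\<lambda>z. z \<in> nonneg_orthant (dim_col A)) u"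
  shows "u \<in> nnls_box A"
proof -
  have uo: "u \<in> nonneg_orthant (dim_col A)" using u by (simp add: is_arg_min_def)
  then have uc: "u \<in> carrier_vec (dim_col A)" and u0: "\<And>l. l < dim_col A \<Longrightarrow> 0 \<le> u $ l"
    by (auto simp: nonneg_orthant_def)
  have nn: "A $$ (i, l) \<ge> 0" if "i < dim_row A" "l < dim_col A" for i l
    using nd that by (auto simp: nonneg_nondegenerate_def)
  have "u $ l \<le> 1 / sq_norm (col A l)" if l: "l < dim_col A" for l
  proof (cases "u $ l = 0")
    case True
    then show ?thesis by (simp add: sq_norm_def scalar_prod_def sum_nonneg)
  next
    case False
    then have pos: "u $ l > 0" using u0[OF l] by simp
    define z where "z = vec (dim_col A) (\<lambda>k. if k = l then 0 else u $ k)"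
    have "z \<in> nonneg_orthant (dim_col A)" using u0 by (auto simp: nonneg_orthant_def z_def)
    from variational_inequality[OF u this]
    have "0 \<le> (\<Sum>k<dim_col A. nnls_grad A u k * (z $ k - u $ k))" .
    also have "\<dots> = (\<Sum>k<dim_col A. if k = l then - nnls_grad A u l * u $ l else 0)"
      by (intro sum.cong) (auto simp: z_def)
    also have "\<dots> = - nnls_grad A u l * u $ l" using l by simp
    finally have "nnls_grad A u l \<le> 0" using pos by (simp add: mult_le_0_iff)
    then have 1: "(\<Sum>i<dim_row A. A $$ (i, l) * (A *\<^sub>v u) $ i) \<le> 1" by (simp add: residual_def)
    have "A $$ (i, l) * (A $$ (i, l) * u $ l) \<le> A $$ (i, l) * (A *\<^sub>v u) $ i" if i: "i < dim_row A" for i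
      unfolding mat_vec_index_sum[OF uc i] using i l nn u0
      by (intro mult_left_mono member_le_sum[of l _ "\<lambda>k. A $$ (i, k) * u $ k"]) auto
    then have "(\<Sum>i<dim_row A. A $$ (i, l) * (A $$ (i, l) * u $ l)) \<le> 1"
      using 1 by (intro order_trans[OF sum_mono 1]) auto
    moreover have "sq_norm (col A l) = (\<Sum>i<dim_row A. A $$ (i, l) * A $$ (i, l))"
      using l by (auto simp: sq_norm_def scalar_prod_def atLeast0LessThan intro!: sum.cong)
    ultimately have "sq_norm (col A l) * u $ l \<le> 1" by (simp add: sum_distrib_right mult.assoc)
    moreover have "sq_norm (col A l) > 0"
    proof -
      obtain i where "i < dim_row A" "A $$ (i, l) \<noteq> 0" using nd l by (auto simp: nonneg_nondegenerate_def)
      then show ?thesis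
        unfolding \<open>sq_norm (col A l) = _\<close>
        by (intro sum_pos2[of _ i]) (auto simp: zero_less_mult_iff)
    qed
    ultimately show ?thesis by (simp add: field_simps)
  qed
  then show ?thesis using uc u0 by (auto simp: nnls_box_def)
qed

section \<open>The potential argument along one run\<close>

text \<open>Strong convexity of a one-dimensional quadratic, at its minimiser over an interval.\<close>

lemma clip_growth:
  assumes "l > 0" "0 \<le> z" "z \<le> 1 / l"
  shows "p * clip l h p + l/2 * (clip l h p - h)\<^sup>2 + l/2 * (z - clip l h p)\<^sup>2 \<le> p * z + l/2 * (z - h)\<^sup>2"
proof -
  let ?c = "clip l h p"
  have "0 \<le> (?c - (h - p / l)) * (z - ?c)"
    using assms by (auto simp: clip_def min_def max_def mult_nonneg_nonneg mult_nonpos_nonpos)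
  then have "0 \<le> l * ((?c - (h - p / l)) * (z - ?c))" using assms(1) by simp
  also have "\<dots> = (p + l * (?c - h)) * (z - ?c)" using assms(1) by (simp add: field_simps)
  finally show ?thesis by (simp add: power2_eq_square algebra_simps)
qed

text \<open>The difference between the importance-weighted partial derivative at the sampled coordinate
  \<open>l\<close> and the full inner product that it estimates.\<close>

definition sampling_noise :: "real mat \<Rightarrow> real vec \<Rightarrow> real vec \<Rightarrow> real vec \<Rightarrow> nat \<Rightarrow> real" where
  "sampling_noise A u z v l = real (dim_col A) * (residual A v l * (u $ l - z $ l))
     - (\<Sum>k<dim_col A. residual A v k * (u $ k - z $ k))"

lemma sum_sampling_noise: "(\<Sum>l<dim_col A. sampling_noise A u z v l) = 0"
  by (simp add: sampling_noise_def sum_subtractf sum_distrib_left[symmetric])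

text \<open>One row of the recursion of the scaled gap. The two sides differ by $\frac{a}{2} (c - q)^2$.\<close>

lemma weighted_average_growth:
  fixes s a b c w q :: real
  assumes "(s + a) * c = s * b + a * w" "a \<ge> 0"
  shows "(s + a) * c\<^sup>2 / 2 - (s + a) * q\<^sup>2 / 2 \<le> s * b\<^sup>2 / 2 - s * q\<^sup>2 / 2 - s / 2 * (c - b)\<^sup>2 + a * (c * (w - q))"
proof -
  have "s * b\<^sup>2 / 2 - s * q\<^sup>2 / 2 - s / 2 * (c - b)\<^sup>2 + a * (c * (w - q)) - ((s + a) * c\<^sup>2 / 2 - (s + a) * q\<^sup>2 / 2)
      = c * (s * b + a * w - (s + a) * c) + a / 2 * (c - q)\<^sup>2"
    by (simp add: power2_eq_square field_simps)
  also have "\<dots> \<ge> 0" using assms by simp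
  finally show ?thesis by simp
qed

text \<open>Young's inequality for both products, each taking half of $\frac12 d^2$.\<close>

lemma two_products_le:
  fixes N p q d :: real
  assumes "N \<ge> 1"
  shows "(N - 1) * (p * d) - N * (q * d) \<le> N\<^sup>2 * p\<^sup>2 + N\<^sup>2 * q\<^sup>2 + d\<^sup>2 / 2"
proof -
  have "N\<^sup>2 * p\<^sup>2 + N\<^sup>2 * q\<^sup>2 + d\<^sup>2 / 2 - ((N - 1) * (p * d) - N * (q * d)) =
      ((N - 1) * p - d / 2)\<^sup>2 + (N * q + d / 2)\<^sup>2 + (2 * N - 1) * p\<^sup>2"
    by (simp add: power2_eq_square field_simps)
  also have "\<dots> \<ge> 0" using assms by simp
  finally show ?thesis by simp
qed

context si_nnls_plus_run
begin

lemma G_eq_residual: "G = residual A"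
  by (auto simp: G_def residual_def fun_eq_iff)

lemma sum_G: "(\<Sum>l<n. G v l * z l) = (\<Sum>i<m. v $ i * (\<Sum>l<n. B i l * z l)) - (\<Sum>l<n. z l)"
proof -
  have "(\<Sum>l<n. G v l * z l) = (\<Sum>l<n. \<Sum>i<m. B i l * v $ i * z l) - (\<Sum>l<n. z l)"
    by (simp add: G_def left_diff_distrib sum_subtractf sum_distrib_right)
  also have "(\<Sum>l<n. \<Sum>i<m. B i l * v $ i * z l) = (\<Sum>i<m. v $ i * (\<Sum>l<n. B i l * z l))"
    by (subst sum.swap) (simp add: sum_distrib_left mult_ac)
  finally show ?thesis .
qed

text \<open>Cauchy-Schwarz in the column index. The factor \<open>n\<close> is lost only where all coordinates
  may differ; a move along one coordinate loses nothing, see \<open>image_move\<close> below.\<close>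

lemma image_sq_le: "(\<Sum>i<m. (\<Sum>l<n. B i l * d l)\<^sup>2) \<le> real n * (\<Sum>l<n. lm l * (d l)\<^sup>2)"
proof -
  have "(\<Sum>i<m. (\<Sum>l<n. B i l * d l)\<^sup>2) \<le> (\<Sum>i<m. (\<Sum>l<n. (B i l * d l)\<^sup>2) * real n)"
    using sum_squared_le_sum_of_squares[of "\<lambda>l. B _ l * d l" "{..<n}"] by (intro sum_mono) simp
  also have "\<dots> = real n * (\<Sum>l<n. \<Sum>i<m. (B i l * d l)\<^sup>2)"
    by (subst sum.swap) (simp add: sum_distrib_left mult.commute[of _ "real n"])
  also have "(\<Sum>l<n. \<Sum>i<m. (B i l * d l)\<^sup>2) = (\<Sum>l<n. lm l * (d l)\<^sup>2)"
    by (simp add: lm_def sum_distrib_right power_mult_distrib power2_eq_square[of "B _ _"])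
  finally show ?thesis .
qed

lemma box_bounds:
  assumes "z \<in> nnls_box A" "l < n"
  shows "0 \<le> z $ l" "z $ l \<le> 1 / lm l"
  using assms sq_norm_col_eq by (auto simp: nnls_box_def)

text \<open>The induction keeps track of the weight $(n - 1) a_{k+1}$ that the next step takes away
  from $x_k$.\<close>

lemma output_nonneg:
  assumes n: "n \<ge> 4" and k: "k \<ge> 1"
  shows "xt k \<in> nonneg_orthant n"
proof -
  have "0 \<le> xt k $ l" if l: "l < n" for l
  proof -
    have x: "0 \<le> x k $ l" for k by (rule box_bounds(1)[OF x_box l])
    have "(real n - 1) * a (k + 1) * x k $ l \<le> S k * xt k $ l"
      using k
    proof (induction k rule: dec_induct)
      case base
      show ?case
        using start n x[of 1] step_size_2[of n] by (simp add: step_sum_1[simplified] numeral_2_eq_2)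
    next
      case (step k)
      have "(real n - 1) * a (Suc k + 1) * x (Suc k) $ l \<le> real n * a (Suc k) * x (Suc k) $ l"
        using step_size_growth[OF n, of "Suc k"] x by (intro mult_right_mono) auto
      then show ?case
        using step xt_index[of "Suc k" l] l by (simp add: algebra_simps)
    qed
    moreover have "0 \<le> (real n - 1) * a (k + 1) * x k $ l"
      using x[of k] n step_pos[of n "k + 1"] by simp
    ultimately have "0 \<le> S k * xt k $ l" by linarith
    then show ?thesis using step_pos[OF n2 k] by (simp add: zero_le_mult_iff)
  qed
  then show ?thesis using xt_carrier[OF k] by (simp add: nonneg_orthant_def)
qed

end

locale si_nnls_plus_comparison = si_nnls_plus_run +
  fixes u :: "real vec"
  assumes u: "u \<in> nnls_box A" and n4: "n \<ge> 4"
begin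

text \<open>In the names below, the primal and the dual side refer to the saddle point form
  $f(x) = \max_y \langle A x, y \rangle - \frac12 \|y\|^2 - 1^T x$ of the objective.\<close>

definition AU :: "nat \<Rightarrow> real" where "AU i = (\<Sum>l<n. B i l * u $ l)"

definition dy :: "nat \<Rightarrow> nat \<Rightarrow> real" where "dy k i = y k $ i - y (k - 1) $ i"

definition dual_move :: "nat \<Rightarrow> real" where "dual_move k = (\<Sum>i<m. (dy k i)\<^sup>2)"

definition primal_move :: "nat \<Rightarrow> real" where
  "primal_move k = (\<Sum>l<n. lm l * (x k $ l - x (k - 1) $ l)\<^sup>2)"

definition Phi :: "nat \<Rightarrow> real vec \<Rightarrow> real" where
  "Phi k z = (\<Sum>l<n. P k l * z $ l + lm l / 2 * (z $ l - x0 $ l)\<^sup>2)"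

definition primal_gap :: "nat \<Rightarrow> real" where "primal_gap k = Phi k u - Phi k (x k)"

definition dual_gap :: "nat \<Rightarrow> real" where
  "dual_gap k = S k * (nnls_obj A (xt k) - nnls_obj A u)"

definition cross :: "nat \<Rightarrow> real" where
  "cross k = a k * (\<Sum>i<m. dy k i * (AX k i - AU i))"

abbreviation "noise k \<equiv> a k * sampling_noise A u (x (k - 1)) (yb (k - 1)) (j k)"

lemma u_carrier: "u \<in> carrier_vec n"
  using u by (auto simp: nnls_box_def)

lemma obj_u: "nnls_obj A u = (\<Sum>i<m. (AU i)\<^sup>2 / 2) - (\<Sum>l<n. u $ l)"
  using nnls_obj_sum[of u A] u_carrier mult_index[OF u_carrier]
  by (simp add: AU_def sum_divide_distrib del: index_mult_mat_vec)

lemma obj_xt: "k \<ge> 1 \<Longrightarrow> nnls_obj A (xt k) = (\<Sum>i<m. (AT k i)\<^sup>2 / 2) - (\<Sum>l<n. xt k $ l)"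
  using nnls_obj_sum[of "xt k" A] xt_carrier[of k] mult_index[OF xt_carrier, of k]
  by (simp add: AT_def sum_divide_distrib del: index_mult_mat_vec)

lemma dual_gap_sum: "k \<ge> 1 \<Longrightarrow> dual_gap k =
    (\<Sum>i<m. S k * (AT k i)\<^sup>2 / 2 - S k * (AU i)\<^sup>2 / 2) - (\<Sum>l<n. S k * xt k $ l - S k * u $ l)"
  by (simp add: dual_gap_def obj_u obj_xt sum_subtractf sum_distrib_left algebra_simps)

lemma dual_gap_1: "dual_gap 1 \<le> a 1 * (\<Sum>l<n. G (y 1) l * (x 1 $ l - u $ l))"
proof -
  have "(\<Sum>i<m. (AX 1 i)\<^sup>2 / 2 - (AU i)\<^sup>2 / 2) \<le> (\<Sum>i<m. AX 1 i * (AX 1 i - AU i))"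
  proof (intro sum_mono)
    fix i
    have "0 \<le> (AX 1 i - AU i)\<^sup>2 / 2" by simp
    then show "(AX 1 i)\<^sup>2 / 2 - (AU i)\<^sup>2 / 2 \<le> AX 1 i * (AX 1 i - AU i)"
      by (simp add: power2_eq_square algebra_simps)
  qed
  moreover have "(\<Sum>l<n. G (y 1) l * (x 1 $ l - u $ l)) =
      (\<Sum>i<m. AX 1 i * (AX 1 i - AU i)) - (\<Sum>l<n. x 1 $ l - u $ l)"
    unfolding sum_G using y_index(1)[of 1] AT_1
    by (simp add: AX_def AU_def right_diff_distrib sum_subtractf)
  moreover have "dual_gap 1 = a 1 * ((\<Sum>i<m. (AX 1 i)\<^sup>2 / 2 - (AU i)\<^sup>2 / 2) - (\<Sum>l<n. x 1 $ l - u $ l))"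
    using obj_xt[of 1] AT_1 start(4)
    by (simp add: dual_gap_def obj_u step_1(2) sum_subtractf del: One_nat_def)
  ultimately show ?thesis using step_pos[OF n2, of 1] by simp
qed

text \<open>Row by row, $y_k$ maximises a quadratic that gains the summand for $w_k$ in this step; its
  concavity yields the negative term. The lower bound
  $f(u) \ge \langle A^T y_k - 1, u \rangle - \frac12 \|y_k\|^2$ accounts for the comparison point.\<close>

lemma dual_gap_step:
  assumes k: "k \<ge> 2"
  shows "dual_gap k \<le> dual_gap (k - 1) - S (k - 1) / 2 * dual_move k
    + a k * (\<Sum>l<n. G (y k) l * (real n * x k $ l - (real n - 1) * x (k - 1) $ l - u $ l))"
proof -
  let ?k = "k - 1"
  let ?W = "\<lambda>i. real n * AX k i - (real n - 1) * AX ?k i - AU i"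
  let ?w = "\<lambda>l. real n * x k $ l - (real n - 1) * x ?k $ l - u $ l"
  have k1: "k \<ge> 1" "?k \<ge> 1" using k by auto
  have S: "S k = S ?k + a k" using step_sum_rec[OF k1(1), of n] .
  have row: "S k * (AT k i)\<^sup>2 / 2 - S k * (AU i)\<^sup>2 / 2 \<le> S ?k * (AT ?k i)\<^sup>2 / 2 - S ?k * (AU i)\<^sup>2 / 2
      - S ?k / 2 * (AT k i - AT ?k i)\<^sup>2 + a k * (AT k i * ?W i)" for i
  proof -
    have "(S ?k + a k) * AT k i = S ?k * AT ?k i + a k * (real n * AX k i - (real n - 1) * AX ?k i)"
      using AT_rec[OF k, of i] by (simp only: S)
    from weighted_average_growth[OF this, of "AU i"] show ?thesis
      using step_pos[OF n2 k1(1)] by (simp add: S)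
  qed
  have dy: "dual_move k = (\<Sum>i<m. (AT k i - AT ?k i)\<^sup>2)"
    using y_index(1)[OF k1(1)] y_index(1)[OF k1(2)] by (simp add: dual_move_def dy_def)
  have "S k * xt k $ l - S k * u $ l = S ?k * xt ?k $ l - S ?k * u $ l + a k * ?w l" if "l < n" for l
    unfolding xt_index[OF k that] unfolding S by (simp add: algebra_simps)
  then have col: "(\<Sum>l<n. S k * xt k $ l - S k * u $ l) =
      (\<Sum>l<n. S ?k * xt ?k $ l - S ?k * u $ l) + a k * (\<Sum>l<n. ?w l)"
    unfolding sum_distrib_left sum.distrib[symmetric] by (intro sum.cong) auto
  have W: "(\<Sum>l<n. B i l * ?w l) = ?W i" for i
    by (simp add: AX_def AU_def right_diff_distrib sum_subtractf sum_distrib_left mult.left_commute)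
  have G: "(\<Sum>l<n. G (y k) l * ?w l) = (\<Sum>i<m. AT k i * ?W i) - (\<Sum>l<n. ?w l)"
    unfolding sum_G W using y_index(1)[OF k1(1)] by simp
  have "dual_gap k \<le> (\<Sum>i<m. S ?k * (AT ?k i)\<^sup>2 / 2 - S ?k * (AU i)\<^sup>2 / 2
      - S ?k / 2 * (AT k i - AT ?k i)\<^sup>2 + a k * (AT k i * ?W i)) - (\<Sum>l<n. S k * xt k $ l - S k * u $ l)"
    unfolding dual_gap_sum[OF k1(1)] by (intro diff_right_mono sum_mono row)
  also have "\<dots> = dual_gap ?k - S ?k / 2 * dual_move k + a k * (\<Sum>l<n. G (y k) l * ?w l)"
    unfolding dual_gap_sum[OF k1(2)] dy G col
    by (simp add: sum.distrib sum_subtractf sum_distrib_left right_diff_distrib)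
  finally show ?thesis .
qed

lemma Phi_growth:
  assumes "k \<ge> 1" and z: "z \<in> nnls_box A"
  shows "Phi k (x k) + (\<Sum>l<n. lm l * (z $ l - x k $ l)\<^sup>2) / 2 \<le> Phi k z"
proof -
  have "Phi k (x k) + (\<Sum>l<n. lm l * (z $ l - x k $ l)\<^sup>2) / 2 =
      (\<Sum>l<n. P k l * x k $ l + lm l / 2 * (x k $ l - x0 $ l)\<^sup>2 + lm l / 2 * (z $ l - x k $ l)\<^sup>2)"
    by (simp add: Phi_def sum.distrib sum_divide_distrib)
  also have "\<dots> \<le> Phi k z"
    unfolding Phi_def
    using clip_growth[OF lm_pos box_bounds[OF z]] x_clip[OF assms(1)] by (intro sum_mono) auto
  finally show ?thesis .
qed

lemma Phi_rec:
  assumes "k \<ge> 2"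
  shows "Phi k z = Phi (k - 1) z + real n * a k * (G (yb (k - 1)) (j k) * z $ j k)"
proof -
  have "Phi k z - Phi (k - 1) z = (\<Sum>l<n. (P k l - P (k - 1) l) * z $ l)"
    unfolding Phi_def sum_subtractf[symmetric] by (intro sum.cong) (auto simp: algebra_simps)
  also have "\<dots> = (\<Sum>l<n. if l = j k then real n * a k * (G (yb (k - 1)) (j k) * z $ j k) else 0)"
    using P_rec[OF assms] by (intro sum.cong) auto
  also have "\<dots> = real n * a k * (G (yb (k - 1)) (j k) * z $ j k)"
    using j[of k] assms by simp
  finally show ?thesis by simp
qed

text \<open>The first iteration uses the full gradient, so this is an identity without noise.\<close>

lemma primal_gap_1:
  "primal_gap 1 = a 1 * (\<Sum>l<n. G (yb 0) l * (u $ l - x 1 $ l)) + phi0 A x0 u - primal_move 1 / 2"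
proof -
  have "phi0 A x0 u = (\<Sum>l<n. lm l / 2 * (u $ l - x0 $ l)\<^sup>2)"
    using u_carrier x0_carrier sq_norm_col_eq
    by (auto simp: phi0_def sq_norm_Lambda_def sum_distrib_left intro!: sum.cong)
  moreover have "primal_move 1 / 2 = (\<Sum>l<n. lm l / 2 * (x 1 $ l - x0 $ l)\<^sup>2)"
    by (simp add: primal_move_def start sum_divide_distrib)
  ultimately show ?thesis
    by (simp add: primal_gap_def Phi_def P_1 sum.distrib sum_subtractf sum_distrib_left algebra_simps)
qed

lemma primal_gap_step:
  assumes k: "k \<ge> 2"
  shows "primal_gap k \<le> primal_gap (k - 1)
    + real n * a k * (G (yb (k - 1)) (j k) * (u $ j k - x k $ j k)) - primal_move k / 2"
proof -
  have "Phi (k - 1) (x (k - 1)) + primal_move k / 2 \<le> Phi (k - 1) (x k)"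
    using Phi_growth[OF _ x_box[of k], of "k - 1"] k by (simp add: primal_move_def)
  then show ?thesis
    unfolding primal_gap_def Phi_rec[OF k] by (simp add: algebra_simps)
qed

lemma primal_gap_ge:
  assumes "k \<ge> 1"
  shows "(\<Sum>i<m. (AX k i - AU i)\<^sup>2) \<le> 2 * real n * primal_gap k"
proof -
  have "(\<Sum>i<m. (AX k i - AU i)\<^sup>2) = (\<Sum>i<m. (\<Sum>l<n. B i l * (u $ l - x k $ l))\<^sup>2)"
    by (simp add: AX_def AU_def right_diff_distrib sum_subtractf power2_commute)
  also have "\<dots> \<le> real n * (\<Sum>l<n. lm l * (u $ l - x k $ l)\<^sup>2)"
    by (rule image_sq_le)
  also have "\<dots> \<le> real n * (2 * primal_gap k)"
    using Phi_growth[OF assms u] by (intro mult_left_mono) (auto simp: primal_gap_def)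
  finally show ?thesis by simp
qed

text \<open>A move along a coordinate direction has the same length in $\|\cdot\|_\Lambda$ as its
  image under \<open>A\<close>. This is what makes the method scale invariant.\<close>

lemma image_move:
  assumes k: "k \<ge> 2"
  shows "(\<Sum>i<m. (AX k i - AX (k - 1) i)\<^sup>2) = primal_move k"
proof -
  have "(\<Sum>i<m. (AX k i - AX (k - 1) i)\<^sup>2) = lm (j k) * (x k $ j k - x (k - 1) $ j k)\<^sup>2"
    by (simp add: AX_rec[OF k] lm_def sum_distrib_right power_mult_distrib power2_eq_square[of "B _ _"])
  also have "\<dots> = (\<Sum>l<n. if l = j k then lm l * (x k $ l - x (k - 1) $ l)\<^sup>2 else 0)"
    using j[of k] k by simp
  also have "\<dots> = primal_move k"
    unfolding primal_move_def using x_unchanged[OF k] by (intro sum.cong) auto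
  finally show ?thesis .
qed

lemma dual_move_1: "dual_move 1 \<le> real n * primal_move 1"
proof -
  have "dual_move 1 = (\<Sum>i<m. (\<Sum>l<n. B i l * (x 1 $ l - x 0 $ l))\<^sup>2)"
    using y_index(1)[of 1] y_index(2) AT_1
    by (simp add: dual_move_def dy_def AX_def right_diff_distrib sum_subtractf)
  also have "\<dots> \<le> real n * primal_move 1"
    using image_sq_le[of "\<lambda>l. x 1 $ l - x 0 $ l"] by (simp add: primal_move_def)
  finally show ?thesis .
qed

definition potential :: "nat \<Rightarrow> real" where
  "potential k = dual_gap k + primal_gap k - cross k + (real n)\<^sup>2 * (a k)\<^sup>2 * dual_move k"

lemma sum_G_diff: "(\<Sum>l<n. G v l * z l) - (\<Sum>l<n. G v' l * z l) = (\<Sum>i<m. (v $ i - v' $ i) * (\<Sum>l<n. B i l * z l))"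
  by (simp add: sum_G left_diff_distrib sum_subtractf)

text \<open>Here all coordinates move at once, hence $\|y_1 - y_0\|^2 \le n \|x_1 - x_0\|_\Lambda^2$, and
  the value of $a_1$ solves $n^3 a_1^2 = \frac12$.\<close>

lemma potential_1: "potential 1 \<le> phi0 A x0 u"
proof -
  let ?z = "\<lambda>l. x 1 $ l - u $ l"
  have "(\<Sum>l<n. G (y 1) l * ?z l) - (\<Sum>l<n. G (yb 0) l * ?z l) = (\<Sum>i<m. dy 1 i * (AX 1 i - AU i))"
    unfolding sum_G_diff by (simp add: dy_def start AX_def AU_def right_diff_distrib sum_subtractf)
  moreover have "(\<Sum>l<n. G (yb 0) l * (u $ l - x 1 $ l)) = - (\<Sum>l<n. G (yb 0) l * ?z l)"
    unfolding sum_negf[symmetric] by (intro sum.cong) (auto simp: algebra_simps)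
  ultimately have "dual_gap 1 + primal_gap 1 \<le> cross 1 + phi0 A x0 u - primal_move 1 / 2"
    using dual_gap_1 primal_gap_1 by (simp add: cross_def algebra_simps)
  moreover have "(real n)\<^sup>2 * (a 1)\<^sup>2 * dual_move 1 \<le> (real n)\<^sup>2 * (a 1)\<^sup>2 * (real n * primal_move 1)"
    by (intro mult_left_mono dual_move_1) auto
  moreover have "(real n)\<^sup>2 * (a 1)\<^sup>2 * (real n * primal_move 1) = (2 * real n ^ 3 * (a 1)\<^sup>2) * primal_move 1 / 2"
    by (simp add: power2_eq_square power3_eq_cube)
  moreover have "2 * real n ^ 3 * (a 1)\<^sup>2 = 1" using step_size_1_sq n4 by simp
  ultimately show ?thesis unfolding potential_def by (simp del: One_nat_def)
qed

text \<open>Of the quadratic terms, $\frac12 \|x_k - x_{k-1}\|_\Lambda^2$ pays for both products with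
  $A (x_k - x_{k-1})$. Their dual parts $n^2 a_{k-1}^2 \|y_{k-1} - y_{k-2}\|^2$ and
  $n^2 a_k^2 \|y_k - y_{k-1}\|^2$ come from the old potential and from half of
  $\frac12 A_{k-1} \|y_k - y_{k-1}\|^2$; the other half pays for the new potential.\<close>

lemma potential_step:
  assumes k: "k \<ge> 2"
  shows "potential k \<le> potential (k - 1) + noise k"
proof -
  let ?k = "k - 1" and ?N = "real n"
  let ?w = "\<lambda>l. ?N * x k $ l - (?N - 1) * x ?k $ l - u $ l"
  let ?D = "\<lambda>i. AX k i - AX ?k i"
  let ?g = "G (yb ?k) (j k)"
  have k1: "k \<ge> 1" "?k \<ge> 1" using k by auto
  have pos: "a k > 0" "a ?k > 0" using step_pos[OF n2 k1(1)] step_pos[OF n2 k1(2)] by auto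
  \<comment> \<open>only coordinate \<open>j k\<close> moves, so the sampled partial derivative sees the whole step\<close>
  have "?g * (x k $ j k - x ?k $ j k) = (\<Sum>l<n. if l = j k then ?g * (x k $ j k - x ?k $ j k) else 0)"
    using j[of k] k by simp
  also have "\<dots> = (\<Sum>l<n. G (yb ?k) l * (x k $ l - x ?k $ l))"
    using x_unchanged[OF k] by (intro sum.cong) auto
  finally have move: "?g * (x k $ j k - x ?k $ j k) = \<dots>" .
  have "(\<Sum>l<n. G (yb ?k) l * ?w l) =
      (\<Sum>l<n. ?N * (G (yb ?k) l * (x k $ l - x ?k $ l)) - G (yb ?k) l * (u $ l - x ?k $ l))"
    by (intro sum.cong) (auto simp: algebra_simps)
  also have "\<dots> = ?N * (?g * (x k $ j k - x ?k $ j k)) - (\<Sum>l<n. G (yb ?k) l * (u $ l - x ?k $ l))"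
    by (simp only: sum_subtractf sum_distrib_left[symmetric] move)
  finally have w: "(\<Sum>l<n. G (yb ?k) l * ?w l) = \<dots>" .
  have sampled: "?N * a k * (?g * (u $ j k - x k $ j k)) = noise k - a k * (\<Sum>l<n. G (yb ?k) l * ?w l)"
    unfolding sampling_noise_def G_eq_residual[symmetric] dims w by (simp add: algebra_simps)
  have W: "(\<Sum>l<n. B i l * ?w l) = ?N * AX k i - (?N - 1) * AX ?k i - AU i" for i
    by (simp add: AX_def AU_def right_diff_distrib sum_subtractf sum_distrib_left mult.left_commute)
  \<comment> \<open>the weight \<open>a (k - 1) / a k\<close> of the extrapolation makes the cross terms telescope\<close>
  have extrapolate: "a k * (y k $ i - yb ?k $ i) = a k * dy k i - a ?k * dy ?k i" if "i < m" for i
    using yb_index[OF k1(2) that] pos k by (simp add: dy_def field_simps)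
  have "a k * ((\<Sum>l<n. G (y k) l * ?w l) - (\<Sum>l<n. G (yb ?k) l * ?w l)) =
      (\<Sum>i<m. a k * (y k $ i - yb ?k $ i) * (?N * AX k i - (?N - 1) * AX ?k i - AU i))"
    unfolding sum_G_diff W by (simp add: sum_distrib_left mult.assoc)
  also have "\<dots> = (\<Sum>i<m. (a k * dy k i - a ?k * dy ?k i) * (?N * AX k i - (?N - 1) * AX ?k i - AU i))"
    using extrapolate by (intro sum.cong) auto
  also have "\<dots> \<le> (\<Sum>i<m. a k * (dy k i * (AX k i - AU i)) - a ?k * (dy ?k i * (AX ?k i - AU i))
      + ?N\<^sup>2 * (a k)\<^sup>2 * (dy k i)\<^sup>2 + ?N\<^sup>2 * (a ?k)\<^sup>2 * (dy ?k i)\<^sup>2 + (?D i)\<^sup>2 / 2)"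
  proof (intro sum_mono)
    fix i
    let ?p = "a k * dy k i" and ?q = "a ?k * dy ?k i"
    have "(?N - 1) * (?p * ?D i) - ?N * (?q * ?D i) \<le> ?N\<^sup>2 * ?p\<^sup>2 + ?N\<^sup>2 * ?q\<^sup>2 + (?D i)\<^sup>2 / 2"
      using n4 by (intro two_products_le) simp
    moreover have "(?p - ?q) * (?N * AX k i - (?N - 1) * AX ?k i - AU i) =
        a k * (dy k i * (AX k i - AU i)) - a ?k * (dy ?k i * (AX ?k i - AU i))
        + ((?N - 1) * (?p * ?D i) - ?N * (?q * ?D i))"
      by (simp add: algebra_simps)
    ultimately show "(?p - ?q) * (?N * AX k i - (?N - 1) * AX ?k i - AU i)
        \<le> a k * (dy k i * (AX k i - AU i)) - a ?k * (dy ?k i * (AX ?k i - AU i))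
      + ?N\<^sup>2 * (a k)\<^sup>2 * (dy k i)\<^sup>2 + ?N\<^sup>2 * (a ?k)\<^sup>2 * (dy ?k i)\<^sup>2 + (?D i)\<^sup>2 / 2"
      by (simp add: power_mult_distrib mult.assoc)
  qed
  also have "\<dots> = cross k - cross ?k + ?N\<^sup>2 * (a k)\<^sup>2 * dual_move k + ?N\<^sup>2 * (a ?k)\<^sup>2 * dual_move ?k
      + primal_move k / 2"
    by (simp add: cross_def dual_move_def image_move[OF k, symmetric] sum.distrib sum_subtractf
        sum_distrib_left sum_divide_distrib)
  finally have "dual_gap k + primal_gap k \<le> dual_gap ?k + primal_gap ?k - S ?k / 2 * dual_move k + noise k
      + cross k - cross ?k + ?N\<^sup>2 * (a k)\<^sup>2 * dual_move k + ?N\<^sup>2 * (a ?k)\<^sup>2 * dual_move ?k"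
    using dual_gap_step[OF k] primal_gap_step[OF k] sampled by (simp add: right_diff_distrib)
  moreover have "2 * (?N\<^sup>2 * (a k)\<^sup>2 * dual_move k) \<le> S ?k / 2 * dual_move k"
  proof -
    have "(2 * (?N\<^sup>2 * (a k)\<^sup>2)) * dual_move k \<le> S ?k / 2 * dual_move k"
      using step_size_sq_le[OF n4 k] by (intro mult_right_mono) (auto simp: dual_move_def sum_nonneg)
    then show ?thesis by (simp add: mult.assoc)
  qed
  ultimately show ?thesis by (simp add: potential_def)
qed

text \<open>The potential still contains $- T_K$, which is recovered from the last dual move and the gap
  of the primal model.\<close>

theorem gap_le_noise:
  assumes K: "K \<ge> 1"
  shows "S K * (nnls_obj A (xt K) - nnls_obj A u) \<le> phi0 A x0 u + (\<Sum>k=2..K. noise k)"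
proof -
  have pot: "potential K \<le> phi0 A x0 u + (\<Sum>k=2..K. noise k)"
    using K
  proof (induction K rule: dec_induct)
    case base
    then show ?case using potential_1 by simp
  next
    case (step k)
    then show ?case using potential_step[of "Suc k"] by simp
  qed
  have "cross K \<le> (\<Sum>i<m. (real n)\<^sup>2 * (a K)\<^sup>2 * (dy K i)\<^sup>2 + (AX K i - AU i)\<^sup>2 / (4 * (real n)\<^sup>2))"
    unfolding cross_def sum_distrib_left
  proof (intro sum_mono)
    fix i
    let ?p = "a K * dy K i" and ?D = "AX K i - AU i"
    have "0 \<le> (real n * ?p - ?D / (2 * real n))\<^sup>2" by simp
    also have "\<dots> = (real n)\<^sup>2 * ?p\<^sup>2 + ?D\<^sup>2 / (4 * (real n)\<^sup>2) - ?p * ?D"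
      using n4 by (simp add: power2_diff power_mult_distrib power_divide)
    finally show "a K * (dy K i * ?D) \<le> (real n)\<^sup>2 * (a K)\<^sup>2 * (dy K i)\<^sup>2 + ?D\<^sup>2 / (4 * (real n)\<^sup>2)"
      by (simp add: power_mult_distrib mult.assoc)
  qed
  also have "\<dots> = (real n)\<^sup>2 * (a K)\<^sup>2 * dual_move K + (\<Sum>i<m. (AX K i - AU i)\<^sup>2) / (4 * (real n)\<^sup>2)"
    by (simp add: dual_move_def sum.distrib sum_distrib_left sum_divide_distrib)
  also have "(\<Sum>i<m. (AX K i - AU i)\<^sup>2) / (4 * (real n)\<^sup>2) \<le> primal_gap K"
  proof -
    have "0 \<le> (\<Sum>i<m. (AX K i - AU i)\<^sup>2)" by (simp add: sum_nonneg)
    then have "0 \<le> 2 * real n * primal_gap K" using primal_gap_ge[OF K] by linarith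
    then have V: "primal_gap K \<ge> 0" using n4 by (simp add: zero_le_mult_iff)
    have "primal_gap K * (2 * real n) \<le> primal_gap K * (4 * (real n)\<^sup>2)"
      using V n4 by (intro mult_left_mono) (auto simp: power2_eq_square)
    then have "(\<Sum>i<m. (AX K i - AU i)\<^sup>2) \<le> primal_gap K * (4 * (real n)\<^sup>2)"
      using primal_gap_ge[OF K] unfolding mult.commute[of "2 * real n" "primal_gap K"] by linarith
    then show ?thesis using n4 by (simp add: pos_divide_le_eq)
  qed
  finally show ?thesis using pot by (simp add: potential_def dual_gap_def)
qed

end

section \<open>Expectations over the sampled coordinates\<close>

text \<open>All random variables of a run with finitely many iterations are functions of finitely many
  samples, which settles measurability and integrability.\<close>

definition determined_by :: "nat \<Rightarrow> nat \<Rightarrow> ((nat \<Rightarrow> nat) \<Rightarrow> 'a) \<Rightarrow> bool" where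
  "determined_by n K F \<longleftrightarrow> (\<forall>w\<in>space (sample_space n). \<forall>w'\<in>space (sample_space n).
     (\<forall>k\<in>{1..K}. w k = w' k) \<longrightarrow> F w = F w')"

lemma determined_byD:
  assumes F: "determined_by n K F" and w: "w \<in> space (sample_space n)" "w' \<in> space (sample_space n)"
    and agree: "\<And>k. 1 \<le> k \<Longrightarrow> k \<le> K \<Longrightarrow> w k = w' k"
  shows "F w = F w'"
proof -
  have "\<forall>k\<in>{1..K}. w k = w' k" using agree by simp
  then show ?thesis
    by (rule F[unfolded determined_by_def, THEN bspec, OF w(1), THEN bspec, OF w(2), THEN mp])
qed

lemma determined_by_coordinate: "k \<in> {1..K} \<Longrightarrow> determined_by n K (\<lambda>w. g (w k))"
  unfolding determined_by_def
proof (intro ballI impI)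
  fix w w' :: "nat \<Rightarrow> nat"
  assume "k \<in> {1..K}" "\<forall>k\<in>{1..K}. w k = w' k"
  then have "w k = w' k" by (rule bspec[rotated])
  then show "g (w k) = g (w' k)" by simp
qed

lemma space_sample_space: "space (sample_space n) = {1..} \<rightarrow>\<^sub>E {0..<n}"
  by (simp add: sample_space_def space_PiM space_uniform_count_measure)

lemma sample_space_update:
  "w \<in> space (sample_space n) \<Longrightarrow> k \<ge> 1 \<Longrightarrow> l < n \<Longrightarrow> w(k := l) \<in> space (sample_space n)"
  unfolding space_sample_space by (auto simp: PiE_def extensional_def)

lemma sample_less: "w \<in> space (sample_space n) \<Longrightarrow> k \<ge> 1 \<Longrightarrow> w k < n"
  unfolding space_sample_space by (auto simp: PiE_def Pi_def)

lemma sample_product_prob_space: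
  "(n::nat) > 0 \<Longrightarrow> product_prob_space (\<lambda>_. uniform_count_measure {0..<n})"
  by (rule product_prob_spaceI, rule prob_space_uniform_count_measure) auto

lemma prob_space_sample_space: "n > 0 \<Longrightarrow> prob_space (sample_space n)"
  unfolding sample_space_def by (intro prob_space_PiM prob_space_uniform_count_measure) auto

text \<open>Completes the first \<open>K\<close> samples to a point of the sample space, in an arbitrary way.\<close>

definition complete_samples :: "nat \<Rightarrow> (nat \<Rightarrow> nat) \<Rightarrow> nat \<Rightarrow> nat" where
  "complete_samples K w = (\<lambda>k\<in>{1..}. if k \<le> K then w k else 0)"

lemma complete_samples_in_space:
  "n > 0 \<Longrightarrow> w \<in> {1..K} \<rightarrow>\<^sub>E {0..<n} \<Longrightarrow> complete_samples K w \<in> space (sample_space n)"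
  unfolding space_sample_space complete_samples_def by (auto simp: PiE_def Pi_def)

text \<open>The law of the first \<open>K\<close> samples is a finite product measure, on which every set is
  measurable and every function is bounded.\<close>

lemma finite_prefix:
  fixes F :: "(nat \<Rightarrow> nat) \<Rightarrow> real"
  assumes n: "n > 0" and F: "determined_by n K F"
  shows "integrable (sample_space n) F" (is ?int)
    and "integrable (PiM {1..K} (\<lambda>_. uniform_count_measure {0..<n})) (\<lambda>w. F (complete_samples K w))" (is ?int')
    and "integral\<^sup>L (sample_space n) F =
      integral\<^sup>L (PiM {1..K} (\<lambda>_. uniform_count_measure {0..<n})) (\<lambda>w. F (complete_samples K w))" (is ?eq)
proof -
  let ?M = "\<lambda>_::nat. uniform_count_measure {0..<n}"
  let ?H = "\<lambda>w. F (complete_samples K w)"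
  interpret product_prob_space ?M "{1..}" by (rule sample_product_prob_space[OF n])
  interpret fin: prob_space "PiM {1..K} ?M"
    using n by (intro prob_space_PiM prob_space_uniform_count_measure) auto
  have "sets (PiM {1..K} ?M) = sets (PiM {1..K} (\<lambda>_. count_space {0..<n}))"
    by (intro sets_PiM_cong) (auto simp: sets_uniform_count_measure)
  then have sets: "sets (PiM {1..K} ?M) = sets (count_space ({1..K} \<rightarrow>\<^sub>E {0..<n}))"
    by (simp add: count_space_PiM_finite)
  have space: "space (PiM {1..K} ?M) = {1..K} \<rightarrow>\<^sub>E {0..<n}"
    by (simp add: space_PiM space_uniform_count_measure)
  have meas: "?H \<in> borel_measurable (PiM {1..K} ?M)"
    unfolding measurable_cong_sets[OF sets refl] by simp
  have fin: "finite ({1..K} \<rightarrow>\<^sub>E {0..<n})" by (intro finite_PiE) auto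
  have "\<bar>?H w\<bar> \<le> (\<Sum>w\<in>{1..K} \<rightarrow>\<^sub>E {0..<n}. \<bar>?H w\<bar>)" if "w \<in> space (PiM {1..K} ?M)" for w
    using that fin unfolding space by (intro member_le_sum) auto
  then show int': ?int'
    by (intro fin.integrable_const_bound[OF _ meas]) (auto intro!: AE_I2)
  have restr: "(\<lambda>w. restrict w {1..K}) \<in> measurable (sample_space n) (PiM {1..K} ?M)"
    unfolding sample_space_def by (intro measurable_restrict_subset) auto
  have distr: "distr (sample_space n) (PiM {1..K} ?M) (\<lambda>w. restrict w {1..K}) = PiM {1..K} ?M"
    unfolding sample_space_def by (intro distr_PiM_restrict_finite) auto
  have cong: "F w = ?H (restrict w {1..K})" if "w \<in> space (sample_space n)" for w
  proof (rule determined_byD[OF F that])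
    show "complete_samples K (restrict w {1..K}) \<in> space (sample_space n)"
      using sample_less[OF that] by (intro complete_samples_in_space[OF n]) auto
  qed (auto simp: complete_samples_def)
  have "integrable (sample_space n) (\<lambda>w. ?H (restrict w {1..K}))"
    by (rule integrable_distr[OF restr]) (simp only: distr int')
  moreover have "integrable (sample_space n) F \<longleftrightarrow> integrable (sample_space n) (\<lambda>w. ?H (restrict w {1..K}))"
    by (rule Bochner_Integration.integrable_cong[OF refl cong])
  ultimately show ?int by simp
  have eq: "integral\<^sup>L (sample_space n) F = integral\<^sup>L (sample_space n) (\<lambda>w. ?H (restrict w {1..K}))"
    by (rule Bochner_Integration.integral_cong[OF refl cong])
  have "integral\<^sup>L (PiM {1..K} ?M) ?H = integral\<^sup>L (sample_space n) (\<lambda>w. ?H (restrict w {1..K}))"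
    using integral_distr[OF restr meas] by (simp only: distr)
  with eq show ?eq by (rule trans[OF _ sym])
qed

text \<open>Averaging over a fresh value of the \<open>k\<close>-th sample does not change an expectation, by
  Fubini's theorem for the remaining samples.\<close>

lemma integral_resample:
  fixes F :: "(nat \<Rightarrow> nat) \<Rightarrow> real"
  assumes n: "n > 0" and F: "determined_by n K F" and k: "1 \<le> k" "k \<le> K"
  shows "integral\<^sup>L (sample_space n) F = integral\<^sup>L (sample_space n) (\<lambda>w. (\<Sum>l<n. F (w(k := l))) / real n)"
proof -
  let ?M = "\<lambda>_::nat. uniform_count_measure {0..<n}"
  let ?I = "{1..K} - {k}"
  let ?G = "\<lambda>w. (\<Sum>l<n. F (w(k := l))) / real n"
  interpret product_prob_space ?M "{1..}" by (rule sample_product_prob_space[OF n])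
  have G: "determined_by n K ?G"
    unfolding determined_by_def
  proof (intro ballI impI)
    fix w w' assume agree: "w \<in> space (sample_space n)" "w' \<in> space (sample_space n)" "\<forall>k\<in>{1..K}. w k = w' k"
    have "F (w(k := l)) = F (w'(k := l))" if "l < n" for l
      using agree k that by (intro determined_byD[OF F] sample_space_update) auto
    then show "?G w = ?G w'" by simp
  qed
  have insert: "insert k ?I = {1..K}" using k by auto
  have split: "integral\<^sup>L (sample_space n) H =
      integral\<^sup>L (PiM ?I ?M) (\<lambda>w. (\<Sum>l<n. H (complete_samples K (w(k := l)))) / real n)"
    if H: "determined_by n K H" for H :: "(nat \<Rightarrow> nat) \<Rightarrow> real"
  proof -
    have "integral\<^sup>L (sample_space n) H = integral\<^sup>L (PiM (insert k ?I) ?M) (\<lambda>w. H (complete_samples K w))"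
      unfolding insert by (rule finite_prefix(3)[OF n H])
    also have "\<dots> = (\<integral>w. (\<integral>l. H (complete_samples K (w(k := l))) \<partial>?M k) \<partial>PiM ?I ?M)"
    proof (rule product_integral_insert[where f = "\<lambda>w. H (complete_samples K w)"])
      show "integrable (PiM (insert k ?I) ?M) (\<lambda>w. H (complete_samples K w))"
        unfolding insert by (rule finite_prefix(2)[OF n H])
    qed auto
    finally show ?thesis by (simp add: integral_uniform_count_measure atLeast0LessThan)
  qed
  have avg: "(\<Sum>l<n. ?G (complete_samples K (w(k := l)))) / real n =
      (\<Sum>l<n. F (complete_samples K (w(k := l)))) / real n" for w
  proof -
    have "(complete_samples K (w(k := l)))(k := l') = complete_samples K (w(k := l'))" for l l'
      using k by (auto simp: complete_samples_def fun_eq_iff)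
    then show ?thesis using n by simp
  qed
  show ?thesis unfolding split[OF F] split[OF G] avg ..
qed

lemma integral_coordinate:
  fixes g :: "nat \<Rightarrow> real"
  assumes n: "n > 0" and k: "1 \<le> k"
  shows "integral\<^sup>L (sample_space n) (\<lambda>w. g (w k)) = (\<Sum>l<n. g l) / real n"
proof -
  interpret prob_space "sample_space n" by (rule prob_space_sample_space[OF n])
  show ?thesis
    using integral_resample[OF n determined_by_coordinate[of k k n g] k] k prob_space by simp
qed

section \<open>The cost of the lazy implementation\<close>

lemma ops_simps:
  "ops (ret v) = 0" "ops (bind_counted p q) = ops p + ops (q (result p))"
  "ops (a +. b) = 1" "ops (a -. b) = 1" "ops (a *. b) = 1"
  "ops (a /. b) = 1" "ops (min_op a b) = 1" "ops (max_op a b) = 1"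
  "ops (sqrt_op a) = 1" "ops (store w i c) = 1" "ops (new_array l) = l"
  by (simp_all add: ret_def bind_counted_def add_op_def sub_op_def mul_op_def div_op_def
      min_op_def max_op_def sqrt_op_def store_def new_array_def)

lemma ops_loop:
  "(\<And>b s. b \<in> set bs \<Longrightarrow> ops (f b s) = c b) \<Longrightarrow> ops (loop f bs s) = sum_list (map c bs)"
  by (induction bs arbitrary: s) (simp_all add: ops_simps)

lemma ops_loop_append: "ops (loop f (bs @ bs') s) = ops (loop f bs s) + ops (loop f bs' (result (loop f bs s)))"
  by (induction bs arbitrary: s) (simp_all add: ops_simps result_simps)

lemma loop_cong: "(\<And>b s. b \<in> set bs \<Longrightarrow> f b s = g b s) \<Longrightarrow> loop f bs s = loop g bs s"
proof (induction bs arbitrary: s)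
  case (Cons b bs)
  have "loop f bs = loop g bs" using Cons.prems by (intro ext Cons.IH) auto
  then show ?case using Cons.prems by simp
qed simp

lemma sum_list_upt: "sum_list (map f [0..<k]) = (\<Sum>i<k. f i :: nat)"
  by (simp add: interv_sum_list_conv_sum_set_nat atLeast0LessThan)

abbreviation col_nnz :: "real mat \<Rightarrow> nat \<Rightarrow> nat" where
  "col_nnz A l \<equiv> length (sparse_col A l)"

lemma nnz_eq_sum: "nnz A = (\<Sum>l<dim_col A. col_nnz A l)"
proof -
  let ?R = "\<lambda>l. {i. i < dim_row A \<and> A $$ (i, l) \<noteq> 0}"
  have col: "card (?R l) = col_nnz A l" for l
    by (auto simp: sparse_col_def length_filter_conv_card intro!: arg_cong[of _ _ card])
  have "{(i, l). i < dim_row A \<and> l < dim_col A \<and> A $$ (i, l) \<noteq> 0} = prod.swap ` (SIGMA l:{..<dim_col A}. ?R l)"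
    by force
  then have "nnz A = card (SIGMA l:{..<dim_col A}. ?R l)"
    by (simp add: nnz_def card_image)
  also have "\<dots> = (\<Sum>l<dim_col A. card (?R l))" by simp
  finally show ?thesis by (simp add: col)
qed

text \<open>Every row and every column contributes a nonzero entry, so costs linear in the dimensions are
  linear in the number of nonzeros.\<close>

lemma dims_le_nnz:
  assumes "nonneg_nondegenerate A"
  shows "dim_row A \<le> nnz A" "dim_col A \<le> nnz A"
proof -
  let ?N = "{(i, l). i < dim_row A \<and> l < dim_col A \<and> A $$ (i, l) \<noteq> 0}"
  have fin: "finite ?N" by (rule finite_subset[of _ "{..<dim_row A} \<times> {..<dim_col A}"]) auto
  have "i \<in> fst ` ?N" if i: "i < dim_row A" for i
  proof -
    obtain j where "j < dim_col A" "A $$ (i, j) \<noteq> 0" using assms i by (auto simp: nonneg_nondegenerate_def)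
    then have "(i, j) \<in> ?N" using i by simp
    from imageI[OF this, of fst] show ?thesis by simp
  qed
  then have "card {..<dim_row A} \<le> card ?N" by (intro surj_card_le[OF fin] subsetI) (simp only: lessThan_iff)
  moreover have "j \<in> snd ` ?N" if j: "j < dim_col A" for j
  proof -
    obtain i where "i < dim_row A" "A $$ (i, j) \<noteq> 0" using assms j by (auto simp: nonneg_nondegenerate_def)
    then have "(i, j) \<in> ?N" using j by simp
    from imageI[OF this, of snd] show ?thesis by simp
  qed
  then have "card {..<dim_col A} \<le> card ?N" by (intro surj_card_le[OF fin] subsetI) (simp only: lessThan_iff)
  ultimately show "dim_row A \<le> nnz A" "dim_col A \<le> nnz A" by (simp_all add: nnz_def)
qed

lemma ops_dot_col: "ops (dot_col c y) = 2 * length c"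
  unfolding dot_col_def by (subst ops_loop[where c = "\<lambda>_. 2"]) (auto simp: ops_simps sum_list_triv)

lemma ops_sq_norm_col: "ops (sq_norm_col c) = 2 * length c"
  unfolding sq_norm_col_def by (subst ops_loop[where c = "\<lambda>_. 2"]) (auto simp: ops_simps sum_list_triv)

lemma ops_add_col: "ops (add_col c h y) = 3 * length c"
  unfolding add_col_def by (subst ops_loop[where c = "\<lambda>_. 3"]) (auto simp: ops_simps sum_list_triv)

lemma ops_dot_extrapolated: "ops (dot_extrapolated c w st) = 6 * length c"
  unfolding dot_extrapolated_def by (subst ops_loop[where c = "\<lambda>_. 6"]) (auto simp: ops_simps sum_list_triv)

lemma ops_prox: "ops (prox l h p) = 5"
  by (simp add: prox_def ops_simps)

lemma sum_col_nnz: "(\<Sum>l<dim_col A. b * col_nnz A l + d) = b * nnz A + d * dim_col A"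
  by (simp add: nnz_eq_sum sum.distrib sum_distrib_left)

lemma ops_mult_sparse: "ops (mult_sparse m (dim_col A) (sparse_col A) v) = m + 3 * nnz A"
proof -
  have "ops (loop (\<lambda>j w. add_col (sparse_col A j) (v j) w) [0..<dim_col A] w) = 3 * nnz A" for w
    using sum_col_nnz[of 3 A 0]
    by (subst ops_loop[where c = "\<lambda>j. 3 * col_nnz A j"]) (simp_all add: ops_add_col sum_list_upt)
  then show ?thesis by (simp add: mult_sparse_def ops_simps)
qed

lemma ops_sq_norms: "ops (sq_norms (dim_col A) (sparse_col A)) = 2 * dim_col A + 2 * nnz A"
proof -
  have "ops (loop (\<lambda>j w. do { t \<leftarrow> sq_norm_col (sparse_col A j); store w j t }) [0..<dim_col A] w) =
      2 * nnz A + dim_col A" for w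
    using sum_col_nnz[of 2 A 1]
    by (subst ops_loop[where c = "\<lambda>j. 2 * col_nnz A j + 1"]) (simp_all add: ops_simps ops_sq_norm_col sum_list_upt)
  then show ?thesis by (simp add: sq_norms_def ops_simps)
qed

lemma ops_lazy_init:
  "ops (lazy_init m (dim_col A) (sparse_col A) lam v) \<le> 5 + 8 * nnz A + 12 * dim_col A + 6 * m"
proof -
  have 1: "ops (loop (\<lambda>j p. do { g \<leftarrow> dot_col (sparse_col A j) y; g \<leftarrow> g -. 1; g \<leftarrow> a *. g; store p j g })
      [0..<dim_col A] w) = 2 * nnz A + 3 * dim_col A" for a y w
    using sum_col_nnz[of 2 A 3]
    by (subst ops_loop[where c = "\<lambda>j. 2 * col_nnz A j + 3"]) (simp_all add: ops_simps ops_dot_col sum_list_upt)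
  have 2: "ops (loop (\<lambda>j x. do { z \<leftarrow> prox (lam j) (v j) (p j); store x j z }) [0..<dim_col A] w) = 6 * dim_col A" for p w
    by (subst ops_loop[where c = "\<lambda>_. 6"]) (simp_all add: ops_simps ops_prox sum_list_triv)
  have 3: "ops (loop (\<lambda>i d. do { t \<leftarrow> y i -. y0 i; store d i t }) [0..<m] w) = 2 * m" for y y0 w
    by (subst ops_loop[where c = "\<lambda>_. 2"]) (simp_all add: ops_simps sum_list_triv)
  show ?thesis
    unfolding lazy_init_def ops_simps ops_mult_sparse 1 2 3 by simp
qed

text \<open>Resetting the support of the previous move is paid for by the iteration that created it:
  the length of \<open>st_supp\<close> acts as the potential of an amortised analysis.\<close>

lemma ops_lazy_step:
  "ops (lazy_step n c lam v k l st) \<le> 40 + 15 * length (c l) + length (st_supp st)"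
  "st_supp (result (lazy_step n c lam v k l st)) = map fst (c l)"
proof -
  have 1: "ops (next_step_size n k st) \<le> 7" by (cases "k = 2") (simp_all add: next_step_size_def ops_simps)
  have 2: "ops (extrapolation n k st a') \<le> 7" for a' by (cases "k = 2") (simp_all add: extrapolation_def ops_simps)
  have 3: "ops (loop (\<lambda>i d. store d i 0) is d) = length is" for "is" d
    by (subst ops_loop[where c = "\<lambda>_. 1"]) (simp_all add: ops_simps sum_list_triv)
  show "ops (lazy_step n c lam v k l st) \<le> 40 + 15 * length (c l) + length (st_supp st)"
    unfolding lazy_step_def ops_simps ops_dot_extrapolated ops_prox ops_add_col 3
    using 1 2[of "result (next_step_size n k st)"] by simp
  show "st_supp (result (lazy_step n c lam v k l st)) = map fst (c l)"
    by (simp add: lazy_step_def result_simps)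
qed

lemma ops_lazy_steps:
  "ops (loop (\<lambda>k st. lazy_step n c lam v k (j k) st) [2..<Suc K] st)
     + length (st_supp (result (loop (\<lambda>k st. lazy_step n c lam v k (j k) st) [2..<Suc K] st)))
   \<le> length (st_supp st) + (\<Sum>k=2..K. 40 + 16 * length (c (j k)))"
proof (induction K)
  case 0
  then show ?case by (simp add: ops_simps result_simps)
next
  case (Suc K)
  let ?st = "result (loop (\<lambda>k st. lazy_step n c lam v k (j k) st) [2..<Suc K] st)"
  show ?case
  proof (cases "K = 0")
    case True
    then show ?thesis by (simp add: ops_simps result_simps)
  next
    case False
    then have "[2..<Suc (Suc K)] = [2..<Suc K] @ [Suc K]" by simp
    then show ?thesis
      using Suc False ops_lazy_step[of n c lam v "Suc K" "j (Suc K)" ?st]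
      by (simp add: ops_loop_append result_loop ops_simps del: upt_Suc)
  qed
qed

lemma ops_lazy_run_le:
  assumes nd: "nonneg_nondegenerate A" and n: "dim_col A \<ge> 1"
  shows "ops (lazy_run A x0 j K) \<le> 40 * nnz A + (\<Sum>k=2..K. 40 + 16 * col_nnz A (j k))"
proof -
  let ?m = "dim_row A" and ?n = "dim_col A" and ?c = "sparse_col A"
  let ?lam = "result (sq_norms ?n ?c)"
  let ?init = "lazy_init ?m ?n ?c ?lam (($) x0)"
  have final: "ops (loop (\<lambda>j z. do { t \<leftarrow> f j /. s; t \<leftarrow> g j +. t; store z j t }) [0..<?n] w) = 3 * ?n" for f g s w
    by (subst ops_loop[where c = "\<lambda>_. 3"]) (simp_all add: ops_simps sum_list_triv)
  have "length (st_supp (result ?init)) = ?m" by (simp add: lazy_init_def result_simps)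
  then show ?thesis
    using ops_lazy_steps[of ?n ?c ?lam "($) x0" j K "result ?init"] ops_lazy_init[of ?m A ?lam "($) x0"]
      dims_le_nnz[OF nd] n
    unfolding lazy_run_def Let_def ops_simps ops_sq_norms final by linarith
qed

lemma lazy_run_cong:
  assumes "\<And>k. k \<in> {1..K} \<Longrightarrow> j k = j' k"
  shows "lazy_run A x0 j K = lazy_run A x0 j' K"
proof -
  have "loop (\<lambda>k st. lazy_step n c lam v k (j k) st) [2..<Suc K] st =
      loop (\<lambda>k st. lazy_step n c lam v k (j' k) st) [2..<Suc K] st" for n c lam v st
    using assms by (intro loop_cong) auto
  then show ?thesis by (simp add: lazy_run_def Let_def)
qed

section \<open>Convergence in expectation\<close>

text \<open>The iterates after \<open>K\<close> steps depend on the first \<open>K\<close> samples only. For the averaged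
  iterate this is visible from the program that computes it; the other iterates are then
  determined by the averaged ones and the samples.\<close>

lemma runs_agree:
  assumes run: "si_nnls_plus_run A m n x0 j x y yb xt"
    and run': "si_nnls_plus_run A m n x0 j' x' y' yb' xt'"
    and agree: "\<And>k. 1 \<le> k \<Longrightarrow> k \<le> K \<Longrightarrow> j k = j' k"
  shows "1 \<le> K \<Longrightarrow> xt K = xt' K" "yb K = yb' K" "x K = x' K"
proof -
  interpret R: si_nnls_plus_run A m n x0 j x y yb xt by fact
  interpret R': si_nnls_plus_run A m n x0 j' x' y' yb' xt' by fact
  have xt: "xt k = xt' k" if "1 \<le> k" "k \<le> K" for k
  proof -
    have "lazy_run A x0 j k = lazy_run A x0 j' k"
      using agree that by (intro lazy_run_cong) auto
    then show ?thesis
      using R.result_lazy_run_aux[OF that(1)] R'.result_lazy_run_aux[OF that(1)] by simp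
  qed
  have y: "y k = y' k" if "k \<le> K" for k
    using xt[of k] R.y_eq[of k] R'.y_eq[of k] R.start(2) R'.start(2) that by (cases "k = 0") simp_all
  have yb: "yb k = yb' k" if "k \<le> K" for k
    using y[of k] y[of "k - 1"] R.yb_eq[of k] R'.yb_eq[of k] R.start(3) R'.start(3) that
    by (cases "k = 0") simp_all
  have P: "R.P K l = R'.P K l" for l
    unfolding R.P_def R'.P_def using yb agree by (intro arg_cong2[of _ _ _ _ "(+)"] sum.cong) auto
  show "1 \<le> K \<Longrightarrow> xt K = xt' K" "yb K = yb' K" using xt yb by auto
  show "x K = x' K"
  proof (cases "K = 0")
    case True
    then show ?thesis using R.start(1) R'.start(1) by simp
  next
    case False
    then have "x K $ l = x' K $ l" if "l < n" for l
      using R.x_clip[of K l] R'.x_clip[of K l] P that by simp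
    then show ?thesis
      using R.x_carrier[of K] R'.x_carrier[of K] by (intro eq_vecI) auto
  qed
qed

locale sampled_si_nnls_plus =
  fixes A :: "real mat" and m n :: nat and x0 :: "real vec"
    and x y yb xt :: "(nat \<Rightarrow> nat) \<Rightarrow> nat \<Rightarrow> real vec"
  assumes A: "A \<in> carrier_mat m n" and nd: "nonneg_nondegenerate A" and n4: "n \<ge> 4"
    and x0: "x0 \<in> nnls_box A"
    and alg: "\<And>w. w \<in> space (sample_space n) \<Longrightarrow> si_nnls_plus A x0 w (x w) (y w) (yb w) (xt w)"
begin

lemma run: "w \<in> space (sample_space n) \<Longrightarrow> si_nnls_plus_run A m n x0 w (x w) (y w) (yb w) (xt w)"
  using A nd n4 x0 alg sample_less by unfold_locales auto

lemma output_determined: "K \<ge> 1 \<Longrightarrow> determined_by n K (\<lambda>w. g (xt w K))"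
  unfolding determined_by_def
proof (intro ballI impI)
  fix w w' assume "K \<ge> 1" "w \<in> space (sample_space n)" "w' \<in> space (sample_space n)"
    and agree: "\<forall>k\<in>{1..K}. w k = w' k"
  then show "g (xt w K) = g (xt w' K)"
    using runs_agree(1)[OF run run, of w w' K] by simp
qed

lemma integrable_output: "K \<ge> 1 \<Longrightarrow> integrable (sample_space n) (\<lambda>w. g (xt w K) :: real)"
  using finite_prefix(1)[OF _ output_determined[of K g]] n4 by simp

definition sampled_noise :: "real vec \<Rightarrow> nat \<Rightarrow> (nat \<Rightarrow> nat) \<Rightarrow> real" where
  "sampled_noise u k w = sampling_noise A u (x w (k - 1)) (yb w (k - 1)) (w k)"

lemma noise_determined:
  assumes k: "k \<ge> 1"
  shows "determined_by n k (sampled_noise u k)"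
  unfolding determined_by_def
proof (intro ballI impI)
  fix w w' assume w: "w \<in> space (sample_space n)" "w' \<in> space (sample_space n)" "\<forall>i\<in>{1..k}. w i = w' i"
  then have "w k = w' k" using k by simp
  moreover have "x w (k - 1) = x w' (k - 1)" "yb w (k - 1) = yb w' (k - 1)"
    using w by (auto intro!: runs_agree(2,3)[OF run[OF w(1)] run[OF w(2)]])
  ultimately show "sampled_noise u k w = sampled_noise u k w'" by (simp add: sampled_noise_def)
qed

text \<open>The iterates that enter the noise of step \<open>k\<close> do not depend on the sample of step \<open>k\<close>, so
  resampling that coordinate averages the noise over all coordinates for fixed iterates.\<close>

lemma integral_noise:
  assumes k: "k \<ge> 1"
  shows "integral\<^sup>L (sample_space n) (sampled_noise u k) = 0"
proof -
  have n: "n > 0" using n4 by simp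
  have "(\<Sum>l<n. sampled_noise u k (w(k := l))) / real n = 0" if w: "w \<in> space (sample_space n)" for w
  proof -
    have "sampled_noise u k (w(k := l)) = sampling_noise A u (x w (k - 1)) (yb w (k - 1)) l" if l: "l < n" for l
    proof -
      have w': "w(k := l) \<in> space (sample_space n)" using w k l by (rule sample_space_update)
      have "x (w(k := l)) (k - 1) = x w (k - 1)" "yb (w(k := l)) (k - 1) = yb w (k - 1)"
        using k by (auto intro!: runs_agree(2,3)[OF run[OF w'] run[OF w]])
      then show ?thesis by (simp add: sampled_noise_def)
    qed
    then have "(\<Sum>l<n. sampled_noise u k (w(k := l))) = (\<Sum>l<dim_col A. sampling_noise A u (x w (k - 1)) (yb w (k - 1)) l)"
      using A by (intro sum.cong) auto
    then show ?thesis by (simp add: sum_sampling_noise)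
  qed
  then have "(LINT w|sample_space n. (\<Sum>l<n. sampled_noise u k (w(k := l))) / real n) = (LINT w|sample_space n. 0)"
    by (rule Bochner_Integration.integral_cong[OF refl])
  then show ?thesis
    using integral_resample[OF n noise_determined[OF k] k order_refl] by simp
qed

theorem expected_gap:
  assumes u: "u \<in> nnls_box A" and K: "K \<ge> 1"
  shows "(LINT w|sample_space n. nnls_obj A (xt w K) - nnls_obj A u) \<le> phi0 A x0 u / step_sum n K"
proof -
  have n: "n > 0" using n4 by simp
  have S: "step_sum n K > 0" using step_pos[of n K] n4 K by simp
  interpret prob_space "sample_space n" by (rule prob_space_sample_space[OF n])
  let ?N = "\<lambda>w. \<Sum>k=2..K. step_size n k * sampled_noise u k w"
  have int: "integrable (sample_space n) (sampled_noise u k)" if "k \<ge> 1" for k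
    by (rule finite_prefix(1)[OF n noise_determined[OF that]])
  have int_N: "integrable (sample_space n) ?N"
    by (intro Bochner_Integration.integrable_sum integrable_mult_right int) auto
  have pointwise: "nnls_obj A (xt w K) - nnls_obj A u \<le> (phi0 A x0 u + ?N w) / step_sum n K"
    if w: "w \<in> space (sample_space n)" for w
  proof -
    interpret si_nnls_plus_comparison A m n x0 w "x w" "y w" "yb w" "xt w" u
      using run[OF w] u n4 by (simp add: si_nnls_plus_comparison_def si_nnls_plus_comparison_axioms_def)
    show ?thesis using gap_le_noise[OF K] S by (simp add: sampled_noise_def field_simps)
  qed
  have "(LINT w|sample_space n. nnls_obj A (xt w K) - nnls_obj A u)
      \<le> (LINT w|sample_space n. (phi0 A x0 u + ?N w) / step_sum n K)"
    using pointwise int_N integrable_output[OF K, of "\<lambda>z. nnls_obj A z - nnls_obj A u"]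
    by (intro integral_mono) auto
  also have "\<dots> = (phi0 A x0 u + (\<Sum>k=2..K. step_size n k * integral\<^sup>L (sample_space n) (sampled_noise u k))) / step_sum n K"
    using int int_N by (simp add: prob_space)
  also have "(\<Sum>k=2..K. step_size n k * integral\<^sup>L (sample_space n) (sampled_noise u k)) = 0"
    using integral_noise by (intro sum.neutral) auto
  finally show ?thesis by simp
qed

end

section \<open>The expected cost and the conclusion\<close>

theorem expected_cost:
  assumes nd: "nonneg_nondegenerate A" and n: "dim_col A \<ge> 1"
  shows "(LINT w|sample_space (dim_col A). real (ops (lazy_run A x0 w K)))
    \<le> 40 * real (nnz A) + real K * (56 * real (nnz A) / real (dim_col A))"
proof -
  let ?n = "dim_col A" and ?M = "sample_space (dim_col A)"
  let ?B = "\<lambda>w. 40 * real (nnz A) + (\<Sum>k=2..K. 40 + 16 * real (col_nnz A (w k)))"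
  have n0: "?n > 0" using n by simp
  interpret prob_space ?M by (rule prob_space_sample_space[OF n0])
  have "determined_by ?n K (\<lambda>w. real (ops (lazy_run A x0 w K)))"
    unfolding determined_by_def
  proof (intro ballI impI)
    fix w w' :: "nat \<Rightarrow> nat" assume "\<forall>k\<in>{1..K}. w k = w' k"
    then have "lazy_run A x0 w K = lazy_run A x0 w' K" by (intro lazy_run_cong) simp
    then show "real (ops (lazy_run A x0 w K)) = real (ops (lazy_run A x0 w' K))" by simp
  qed
  note int = finite_prefix(1)[OF n0 this]
  have int_col: "integrable ?M (\<lambda>w. real (col_nnz A (w k)))" if "k \<ge> 1" for k
    using that by (intro finite_prefix(1)[OF n0 determined_by_coordinate[of k k]]) simp
  have "real (ops (lazy_run A x0 w K)) \<le> ?B w" for w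
    using of_nat_mono[OF ops_lazy_run_le[OF nd n, of x0 w K], where ?'a = real] by simp
  moreover have int_k: "integrable ?M (\<lambda>w. 40 + 16 * real (col_nnz A (w k)))" if "k \<in> {2..K}" for k
    using int_col[of k] that by simp
  have int_sum: "integrable ?M (\<lambda>w. \<Sum>k=2..K. 40 + 16 * real (col_nnz A (w k)))"
    by (rule Bochner_Integration.integrable_sum[OF int_k])
  ultimately have "(LINT w|?M. real (ops (lazy_run A x0 w K))) \<le> integral\<^sup>L ?M ?B"
    by (intro integral_mono int Bochner_Integration.integrable_add integrable_const) auto
  also have "\<dots> = 40 * real (nnz A) + (LINT w|?M. (\<Sum>k=2..K. 40 + 16 * real (col_nnz A (w k))))"
    using int_sum by (subst Bochner_Integration.integral_add) (simp_all add: prob_space)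
  also have "(LINT w|?M. (\<Sum>k=2..K. 40 + 16 * real (col_nnz A (w k)))) =
      (\<Sum>k=2..K. LINT w|?M. 40 + 16 * real (col_nnz A (w k)))"
    by (rule Bochner_Integration.integral_sum[OF int_k])
  also have "\<dots> = (\<Sum>k=2..K. 40 + 16 * (LINT w|?M. real (col_nnz A (w k))))"
    using int_col by (intro sum.cong refl) (simp add: prob_space)
  also have "(\<Sum>k=2..K. 40 + 16 * (LINT w|?M. real (col_nnz A (w k)))) = (\<Sum>k=2..K. 40 + 16 * (real (nnz A) / real ?n))"
    using integral_coordinate[OF n0, of _ "\<lambda>l. real (col_nnz A l)"]
    by (intro sum.cong refl) (simp add: nnz_eq_sum)
  also have "\<dots> \<le> (\<Sum>k=1..K. 40 + 16 * (real (nnz A) / real ?n))"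
    by (intro sum_mono2) auto
  also have "\<dots> = real K * (40 + 16 * (real (nnz A) / real ?n))" by simp
  also have "\<dots> \<le> real K * (56 * real (nnz A) / real ?n)"
  proof (intro mult_left_mono)
    have "1 \<le> real (nnz A) / real ?n" using dims_le_nnz(2)[OF nd] n0 by simp
    then show "40 + 16 * (real (nnz A) / real ?n) \<le> 56 * real (nnz A) / real ?n" by simp
  qed simp
  finally show ?thesis by simp
qed

text \<open>As \<open>n \<ge> 4\<close> gives \<open>ln n \<ge> 1\<close>, the linear costs and the rounding of the number of iterations
  are absorbed by the logarithmic term.\<close>

lemma expected_cost_bound:
  assumes nd: "nonneg_nondegenerate A" and A: "dim_col A = n" and n: "n \<ge> 4" and \<epsilon>: "\<epsilon> > 0"
  shows "(LINT w|sample_space n.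
      real (ops (lazy_run A x0 w (nat \<lceil>5/2 * real n * ln (real n) + 6 * real n / sqrt \<epsilon>\<rceil>))))
    \<le> 336 * (real (nnz A) * (ln (real n) + 1 / sqrt \<epsilon>))"
proof -
  let ?L = "ln (real n)" and ?e = "1 / sqrt \<epsilon>" and ?N = "real (nnz A)"
  define K where "K = nat \<lceil>5/2 * real n * ?L + 6 * real n / sqrt \<epsilon>\<rceil>"
  have L: "?L \<ge> 1" by (rule ln_ge_1[OF n])
  have e: "?e > 0" using \<epsilon> by simp
  have "0 \<le> 5/2 * real n * ?L + 6 * real n / sqrt \<epsilon>" using L \<epsilon> by simp
  then have "real K \<le> 5/2 * real n * ?L + 6 * real n / sqrt \<epsilon> + 1"
    unfolding K_def by linarith
  moreover have "1 \<le> real n * ?L"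
    using mult_mono[of 1 "real n" 1 ?L] n L by simp
  ultimately have "real K \<le> real n * (7/2 * ?L + 6 * ?e)"
    by (simp add: algebra_simps)
  then have "real K * (56 * ?N / real n) \<le> real n * (7/2 * ?L + 6 * ?e) * (56 * ?N / real n)"
    by (intro mult_right_mono) auto
  also have "\<dots> = ?N * (196 * ?L + 336 * ?e)" using n by (simp add: field_simps)
  finally have "40 * ?N + real K * (56 * ?N / real n) \<le> ?N * (40 + 196 * ?L + 336 * ?e)"
    by (simp add: algebra_simps)
  also have "\<dots> \<le> ?N * (336 * (?L + ?e))"
    using L e by (intro mult_left_mono) auto
  also have "\<dots> = 336 * (?N * (?L + ?e))" by (rule mult.left_commute)
  finally have "40 * ?N + real K * (56 * ?N / real n) \<le> 336 * (?N * (?L + ?e))" .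
  then show ?thesis
    using expected_cost[OF nd, of x0 K] A n unfolding K_def by simp
qed

theorem theorem3p1:
  "\<exists>C>0. \<forall>(m::nat) (n::nat) (A::real mat) (\<epsilon>::real) (x0::real vec) (xstar::real vec)
      (x :: (nat \<Rightarrow> nat) \<Rightarrow> nat \<Rightarrow> real vec) y yb xt.
     n \<ge> 4 \<longrightarrow> A \<in> carrier_mat m n \<longrightarrow> nonneg_nondegenerate A \<longrightarrow> \<epsilon> > 0 \<longrightarrow> x0 \<in> nnls_box A \<longrightarrow>
     (\<forall>\<omega>\<in>space (sample_space n). si_nnls_plus A x0 \<omega> (x \<omega>) (y \<omega>) (yb \<omega>) (xt \<omega>)) \<longrightarrow>
     is_arg_min (nnls_obj A) (\<lambda>z. z \<in> nonneg_orthant n) xstar \<longrightarrow>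
       (\<forall>K\<ge>2.
          (LINT \<omega>|sample_space n. gradient (nnls_obj A) (xt \<omega> K) \<bullet> (xt \<omega> K - xstar))
            \<le> 2 * phi0 A x0 xstar / step_sum n K \<and>
          2 * phi0 A x0 xstar / step_sum n K = sq_norm_Lambda A (x0 - xstar) / step_sum n K \<and>
          (LINT \<omega>|sample_space n. nnls_obj A (xt \<omega> K) - nnls_obj A xstar)
            \<le> phi0 A x0 xstar / step_sum n K \<and>
          phi0 A x0 xstar / step_sum n K = sq_norm_Lambda A (x0 - xstar) / (2 * step_sum n K)) \<and>
       (\<forall>K::nat. real K \<ge> 5/2 * real n * ln (real n) \<longrightarrow>
          step_sum n K \<ge> (real K - 5/2 * real n * ln (real n))\<^sup>2 / (36 * (real n)\<^sup>2)) \<and>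
       (phi0 A x0 xstar \<le> \<bar>nnls_obj A xstar\<bar> \<longrightarrow>
          (\<forall>K::nat. real K \<ge> 5/2 * real n * ln (real n) + 6 * real n / sqrt \<epsilon> \<longrightarrow>
            (LINT \<omega>|sample_space n. nnls_obj A (xt \<omega> K) - nnls_obj A xstar)
              \<le> \<epsilon> * \<bar>nnls_obj A xstar\<bar>)) \<and>
       (LINT \<omega>|sample_space n.
          real (ops (lazy_run A x0 \<omega> (nat \<lceil>5/2 * real n * ln (real n) + 6 * real n / sqrt \<epsilon>\<rceil>))))
         \<le> C * (real (nnz A) * (ln (real n) + 1 / sqrt \<epsilon>))"
proof (intro exI[of _ 336] conjI allI impI)
  fix m n :: nat and A :: "real mat" and \<epsilon> :: real and x0 xstar :: "real vec"
    and x y yb xt :: "(nat \<Rightarrow> nat) \<Rightarrow> nat \<Rightarrow> real vec"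
  assume n: "n \<ge> 4" and A: "A \<in> carrier_mat m n" and nd: "nonneg_nondegenerate A" and \<epsilon>: "\<epsilon> > 0"
    and x0: "x0 \<in> nnls_box A"
    and alg: "\<forall>\<omega>\<in>space (sample_space n). si_nnls_plus A x0 \<omega> (x \<omega>) (y \<omega>) (yb \<omega>) (xt \<omega>)"
    and xstar: "is_arg_min (nnls_obj A) (\<lambda>z. z \<in> nonneg_orthant n) xstar"
  have dim: "dim_col A = n" using A by auto
  interpret sampled_si_nnls_plus A m n x0 x y yb xt
    using A nd n x0 alg by unfold_locales auto
  have u: "xstar \<in> nnls_box A" using minimiser_in_box[OF nd] xstar dim by simp
  have carrier: "xstar \<in> carrier_vec n" "x0 \<in> carrier_vec n"
    using u x0 dim by (auto simp: nnls_box_def)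
  have phi0: "phi0 A x0 xstar = sq_norm_Lambda A (x0 - xstar) / 2"
    using carrier dim by (simp add: phi0_def sq_norm_Lambda_def power2_commute)
  moreover have "sq_norm_Lambda A (x0 - xstar) \<ge> 0"
    unfolding sq_norm_Lambda_def
    by (intro sum_nonneg mult_nonneg_nonneg) (auto simp: sq_norm_def scalar_prod_def sum_nonneg)
  ultimately have phi0_nonneg: "phi0 A x0 xstar \<ge> 0" by simp
  have gap: "(LINT \<omega>|sample_space n. nnls_obj A (xt \<omega> K) - nnls_obj A xstar) \<le> phi0 A x0 xstar / step_sum n K"
    if "K \<ge> 1" for K
    using expected_gap[OF u that] .
  {
    fix K :: nat assume "K \<ge> 2"
    then have K: "K \<ge> 1" by simp
    show "2 * phi0 A x0 xstar / step_sum n K = sq_norm_Lambda A (x0 - xstar) / step_sum n K"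
      "phi0 A x0 xstar / step_sum n K = sq_norm_Lambda A (x0 - xstar) / (2 * step_sum n K)"
      by (simp_all add: phi0)
    show "(LINT \<omega>|sample_space n. nnls_obj A (xt \<omega> K) - nnls_obj A xstar) \<le> phi0 A x0 xstar / step_sum n K"
      by (rule gap[OF K])
    have pointwise: "gradient (nnls_obj A) (xt w K) \<bullet> (xt w K - xstar) \<le> 2 * (nnls_obj A (xt w K) - nnls_obj A xstar)"
      if w: "w \<in> space (sample_space n)" for w
    proof -
      interpret R: si_nnls_plus_run A m n x0 w "x w" "y w" "yb w" "xt w" by (rule run[OF w])
      have "xt w K \<in> nonneg_orthant (dim_col A)" using R.output_nonneg[OF n K] dim by simp
      then show ?thesis
        using quadratic_growth[of A xstar "xt w K"] gradient_scalar_prod[of "xt w K" A xstar] xstar carrier dim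
          R.xt_carrier[OF K] by simp
    qed
    have "(LINT \<omega>|sample_space n. gradient (nnls_obj A) (xt \<omega> K) \<bullet> (xt \<omega> K - xstar))
        \<le> (LINT \<omega>|sample_space n. 2 * (nnls_obj A (xt \<omega> K) - nnls_obj A xstar))"
      using pointwise integrable_output[OF K, of "\<lambda>z. gradient (nnls_obj A) z \<bullet> (z - xstar)"]
        integrable_output[OF K, of "\<lambda>z. 2 * (nnls_obj A z - nnls_obj A xstar)"]
      by (intro integral_mono) auto
    also have "\<dots> = 2 * (LINT \<omega>|sample_space n. nnls_obj A (xt \<omega> K) - nnls_obj A xstar)"
      by (rule integral_mult_right_zero)
    finally show "(LINT \<omega>|sample_space n. gradient (nnls_obj A) (xt \<omega> K) \<bullet> (xt \<omega> K - xstar))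
        \<le> 2 * phi0 A x0 xstar / step_sum n K"
      using gap[OF K] by simp
  }
  show "step_sum n K \<ge> (real K - 5/2 * real n * ln (real n))\<^sup>2 / (36 * (real n)\<^sup>2)"
    if "real K \<ge> 5/2 * real n * ln (real n)" for K
    using step_sum_lower_bound[OF n that] .
  show "(LINT \<omega>|sample_space n. nnls_obj A (xt \<omega> K) - nnls_obj A xstar) \<le> \<epsilon> * \<bar>nnls_obj A xstar\<bar>"
    if small: "phi0 A x0 xstar \<le> \<bar>nnls_obj A xstar\<bar>"
      and K: "real K \<ge> 5/2 * real n * ln (real n) + 6 * real n / sqrt \<epsilon>" for K
  proof -
    have pos: "6 * real n / sqrt \<epsilon> > 0" "5/2 * real n * ln (real n) > 0" using n \<epsilon> ln_ge_1[OF n] by auto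
    have K1: "K \<ge> 1" using K pos by (cases K) auto
    have "(6 * real n / sqrt \<epsilon>)\<^sup>2 \<le> (real K - 5/2 * real n * ln (real n))\<^sup>2"
      using K pos by (intro power_mono) auto
    then have "(6 * real n / sqrt \<epsilon>)\<^sup>2 / (36 * (real n)\<^sup>2)
        \<le> (real K - 5/2 * real n * ln (real n))\<^sup>2 / (36 * (real n)\<^sup>2)"
      by (rule divide_right_mono) simp
    also have "\<dots> \<le> step_sum n K"
      using K pos by (intro step_sum_lower_bound[OF n]) linarith
    finally have "(6 * real n / sqrt \<epsilon>)\<^sup>2 / (36 * (real n)\<^sup>2) \<le> step_sum n K" .
    moreover have "(6 * real n / sqrt \<epsilon>)\<^sup>2 / (36 * (real n)\<^sup>2) = 1 / \<epsilon>"
      using n \<epsilon> by (simp add: power_divide power_mult_distrib)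
    ultimately have "1 / \<epsilon> \<le> step_sum n K" by simp
    then have "1 \<le> \<epsilon> * step_sum n K" using \<epsilon> by (simp add: field_simps)
    then have "phi0 A x0 xstar * 1 \<le> phi0 A x0 xstar * (\<epsilon> * step_sum n K)"
      using phi0_nonneg by (rule mult_left_mono)
    moreover have "step_sum n K > 0" using step_pos[of n K] n K1 by simp
    ultimately have "phi0 A x0 xstar / step_sum n K \<le> \<epsilon> * phi0 A x0 xstar"
      by (simp add: field_simps)
    also have "\<dots> \<le> \<epsilon> * \<bar>nnls_obj A xstar\<bar>" using small \<epsilon> by simp
    finally show ?thesis using gap[OF K1] by linarith
  qed
  show "(LINT \<omega>|sample_space n.
      real (ops (lazy_run A x0 \<omega> (nat \<lceil>5/2 * real n * ln (real n) + 6 * real n / sqrt \<epsilon>\<rceil>))))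
     \<le> 336 * (real (nnz A) * (ln (real n) + 1 / sqrt \<epsilon>))"
    by (rule expected_cost_bound[OF nd dim n \<epsilon>])
qed simp

end
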